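(* Let $L^-_{\mathrm{conj}}>0$ and let $X=L^\infty((-\infty,-L^-_{\mathrm{conj}}],\mathbb{C}^4)$. For $j=1,2$ let $W_j^{-,\mathrm{u}}\in X$ be a fixed point of $\mathcal{F}_-$ (defined in the context with this $j$), so that $x\mapsto e^{\mu_j^{\mathrm{u}}x}W_j^{-,\mathrm{u}}(x)$, $j=1,2$, are solutions of $Q'=B(x)Q$ spanning $\mathbb{C}\mathbb{E}^{\mathrm{u}}_-(x)$. Suppose that for $j=1,2$ $$\|W_j^{-,\mathrm{u}}-\check V_j^{\mathrm{u}}\|_X\le\epsilon\,\|\check V_j^{\mathrm{u}}\|.$$ If $L^-_{\mathrm{conj}}$ is chosen so that $$\epsilon<\frac{1}{8\rho^{3/2}},$$ then $\mathbb{E}^{\mathrm{u}}_-(x)\cap\ell_{\mathrm{sand}}=\{0\}$ for all $x\le-L^-_{\mathrm{conj}}$.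
   Context: Fix $\hat\mu,\hat\nu>0$ and $f(u)=\hat\nu u^2-u^3-\hat\mu u$. Let $\varphi:\mathbb{R}\to\mathbb{R}$ be a (nonzero) pulse: $0=-(1+\partial_x^2)^2\varphi+f(\varphi)$, $\lim_{|x|\to\infty}\varphi(x)=0$. Consider $Q'=B(x)Q$ with $$B(x)=\begin{pmatrix}0&0&0&1\\0&0&1&-2\\-1+f'(\varphi(x))&0&0&0\\0&1&0&0\end{pmatrix},\qquad B_\infty=\lim_{|x|\to\infty}B(x),\qquad \tilde B(x)=B(x)-B_\infty .$$ There are $K_B,C_B>0$ with $\|B(x)-B_\infty\|\le K_Be^{-C_B|x|}$. $\mathbb{E}^{\mathrm{u}}_-(x)\subset\mathbb{R}^4$ is the (two-dimensional) set of values at $x$ of real solutions of $Q'=B(x)Q$ that tend to $0$ as $x\to-\infty$; $\mathbb{C}\mathbb{E}^{\mathrm{u}}_-(x)\subset\mathbb{C}^4$ is the same for complex-valued solutions. $\ell_{\mathrm{sand}}=\{(0,u_1,u_2,0)^T:u_1,u_2\in\mathbb{R}\}$. Let $\rho=\sqrt{1+\hat\mu}$, $\tan\theta=-\sqrt{\hat\mu}$ with $\theta\in(\pi/2,\pi)$. The eigenvalues of $B_\infty$ with positive real part are $\mu_1^{\mathrm{u}}=\sqrt\rho e^{i\theta/2}$, $\mu_2^{\mathrm{u}}=\sqrt\rho e^{-i\theta/2}$, with eigenvectors $$\check V_1^{\mathrm{u}}=\Big(\tfrac1\rho e^{-i\theta},\,1,\,\sqrt\rho e^{i\theta/2}+\tfrac{2}{\sqrt\rho}e^{-i\theta/2},\,\tfrac1{\sqrt\rho}e^{-i\theta/2}\Big)^T,\qquad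 \check V_2^{\mathrm{u}}=\overline{\check V_1^{\mathrm{u}}}.$$ For fixed $j\in\{1,2\}$, let $\mathcal{P}^{\mathrm{cu}}$ and $\mathcal{P}^{\mathrm{s}}$ be the spectral projections of $B_\infty-\mu_j^{\mathrm{u}}I$ onto the eigenspaces for eigenvalues with zero real part and with negative real part, respectively (complementary projections). Define $\mathcal{F}_-:X\to X$ by $$\mathcal{F}_-(W)(x)=\check V_j^{\mathrm{u}}+\int_{-\infty}^x e^{(B_\infty-\mu_j^{\mathrm{u}}I)(x-y)}\mathcal{P}^{\mathrm{s}}\tilde B(y)W(y)\,dy-\int_x^{-L^-_{\mathrm{conj}}}e^{(B_\infty-\mu_j^{\mathrm{u}}I)(x-y)}\mathcal{P}^{\mathrm{cu}}\tilde B(y)W(y)\,dy .$$ Norms: Euclidean norm on $\mathbb{C}^d$, induced operator norm on matrices, supremum norm on $X$. *)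

theory Defs
  imports "HOL-Analysis.Analysis" "HOL-Probability.Essential_Supremum"
begin

section \<open>Pulses and the linearised first-order system\<close>

definition nonlin :: "real \<Rightarrow> real \<Rightarrow> real \<Rightarrow> real" where
  "nonlin \<mu> \<nu> u = \<nu> * u\<^sup>2 - u ^ 3 - \<mu> * u"

definition one_plus_dxx :: "(real \<Rightarrow> real) \<Rightarrow> real \<Rightarrow> real" where
  "one_plus_dxx g x = g x + deriv (deriv g) x"

text \<open>\<open>deriv\<close> is total, so the classical regularity of a solution (existence of the first four
  derivatives) is required explicitly.\<close>

definition pulse :: "real \<Rightarrow> real \<Rightarrow> (real \<Rightarrow> real) \<Rightarrow> bool" where
  "pulse \<mu> \<nu> \<phi> \<longleftrightarrow>
     (\<forall>k<4. \<forall>x. (deriv ^^ k) \<phi> differentiable (at x)) \<and>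
     (\<forall>x. 0 = - one_plus_dxx (one_plus_dxx \<phi>) x + nonlin \<mu> \<nu> (\<phi> x)) \<and>
     (\<phi> \<longlongrightarrow> 0) at_infinity \<and>
     (\<exists>x. \<phi> x \<noteq> 0)"

definition B_mat :: "real \<Rightarrow> real \<Rightarrow> (real \<Rightarrow> real) \<Rightarrow> real \<Rightarrow> real^4^4" where
  "B_mat \<mu> \<nu> \<phi> x =
     vector [vector [0, 0, 0, 1],
             vector [0, 0, 1, -2],
             vector [-1 + deriv (nonlin \<mu> \<nu>) (\<phi> x), 0, 0, 0],
             vector [0, 1, 0, 0]]"

definition B_inf :: "real \<Rightarrow> real \<Rightarrow> (real \<Rightarrow> real) \<Rightarrow> real^4^4" where
  "B_inf \<mu> \<nu> \<phi> = Lim at_infinity (B_mat \<mu> \<nu> \<phi>)"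

definition B_tilde :: "real \<Rightarrow> real \<Rightarrow> (real \<Rightarrow> real) \<Rightarrow> real \<Rightarrow> real^4^4" where
  "B_tilde \<mu> \<nu> \<phi> x = B_mat \<mu> \<nu> \<phi> x - B_inf \<mu> \<nu> \<phi>"

definition Eu_minus :: "real \<Rightarrow> real \<Rightarrow> (real \<Rightarrow> real) \<Rightarrow> real \<Rightarrow> (real^4) set" where
  "Eu_minus \<mu> \<nu> \<phi> x =
     {Q x | Q. (\<forall>y. (Q has_vector_derivative (B_mat \<mu> \<nu> \<phi> y *v Q y)) (at y)) \<and>
               (Q \<longlongrightarrow> 0) at_bot}"

definition l_sand :: "(real^4) set" where
  "l_sand = {vector [0, u1, u2, 0] | u1 u2. True}"


section \<open>Unstable eigenvalues and eigenvectors of the limiting matrix\<close>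

definition rho :: "real \<Rightarrow> real" where
  "rho \<mu> = sqrt (1 + \<mu>)"

definition mu_u :: "real \<Rightarrow> real \<Rightarrow> nat \<Rightarrow> complex" where
  "mu_u \<rho> \<theta> j =
     (if j = 1 then of_real (sqrt \<rho>) * exp (\<i> * of_real (\<theta> / 2))
      else of_real (sqrt \<rho>) * exp (- \<i> * of_real (\<theta> / 2)))"

definition V1_u :: "real \<Rightarrow> real \<Rightarrow> complex^4" where
  "V1_u \<rho> \<theta> =
     vector [1 / of_real \<rho> * exp (- \<i> * of_real \<theta>),
             1,
             of_real (sqrt \<rho>) * exp (\<i> * of_real (\<theta> / 2))
               + 2 / of_real (sqrt \<rho>) * exp (- \<i> * of_real (\<theta> / 2)),
             1 / of_real (sqrt \<rho>) * exp (- \<i> * of_real (\<theta> / 2))]"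

definition V_u :: "real \<Rightarrow> real \<Rightarrow> nat \<Rightarrow> complex^4" where
  "V_u \<rho> \<theta> j = (if j = 1 then V1_u \<rho> \<theta> else (\<chi> i. cnj (V1_u \<rho> \<theta> $ i)))"


section \<open>Matrix exponential and spectral projections\<close>

abbreviation cmat :: "real^'n^'m \<Rightarrow> complex^'n^'m" where
  "cmat \<equiv> map_matrix complex_of_real"

definition mat_pow :: "'a::semiring_1^'n^'n \<Rightarrow> nat \<Rightarrow> 'a^'n^'n" where
  "mat_pow A k = (((**) A) ^^ k) (mat 1)"

text \<open>The power \<open>^\<close> on the type of square matrices is not available (and the multiplication
  \<open>*\<close> is componentwise), so the exponential series is written with \<open>mat_pow\<close>.\<close>

definition mat_exp :: "complex^'n^'n \<Rightarrow> complex^'n^'n" where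
  "mat_exp A = (\<Sum>k. (1 / fact k) *\<^sub>R mat_pow A k)"

text \<open>The sum of the generalised eigenspaces of \<open>A\<close> for the eigenvalues lying in \<open>S\<close>; the spectral
  projection is the projection onto it along the corresponding sum for the remaining eigenvalues.\<close>

definition spectral_subspace :: "complex^'n^'n \<Rightarrow> complex set \<Rightarrow> (complex^'n) set" where
  "spectral_subspace A S = vec.span {v. \<exists>l\<in>S. \<exists>k. mat_pow (A - mat l) k *v v = 0}"

definition spectral_projection :: "complex^'n^'n \<Rightarrow> complex set \<Rightarrow> complex^'n^'n" where
  "spectral_projection A S =
     (THE P. P ** P = P \<and>
             range ((*v) P) = spectral_subspace A S \<and>
             {v. P *v v = 0} = spectral_subspace A (- S))"


section \<open>The fixed-point map\<close>

text \<open>Elements of \<open>L\<^sup>\<infinity>((-\<infinity>, a], \<complex>\<^sup>4)\<close> are represented by functions on \<open>\<real>\<close>, of which only the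
  restriction to \<open>(-\<infinity>, a]\<close> matters, up to equality almost everywhere.\<close>

definition Linf_norm :: "real \<Rightarrow> (real \<Rightarrow> complex^4) \<Rightarrow> ereal" where
  "Linf_norm a W = esssup (lebesgue_on {..a}) (\<lambda>x. ereal (norm (W x)))"

definition Linf :: "real \<Rightarrow> (real \<Rightarrow> complex^4) set" where
  "Linf a = {W. W \<in> borel_measurable (lebesgue_on {..a}) \<and> Linf_norm a W < \<infinity>}"

definition F_minus ::
  "real \<Rightarrow> real \<Rightarrow> (real \<Rightarrow> real) \<Rightarrow> real \<Rightarrow> real \<Rightarrow> nat \<Rightarrow> (real \<Rightarrow> complex^4) \<Rightarrow> real \<Rightarrow> complex^4"
  where
  "F_minus \<mu> \<nu> \<phi> \<theta> L j W x =
     (let A = cmat (B_inf \<mu> \<nu> \<phi>) - mat (mu_u (rho \<mu>) \<theta> j);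
          Pcu = spectral_projection A {z. Re z = 0};
          Ps = spectral_projection A {z. Re z < 0}
      in V_u (rho \<mu>) \<theta> j
         + (LINT y:{..x}|lebesgue.
              (mat_exp ((x - y) *\<^sub>R A) ** Ps ** cmat (B_tilde \<mu> \<nu> \<phi> y)) *v W y)
         - (LINT y:{x..-L}|lebesgue.
              (mat_exp ((x - y) *\<^sub>R A) ** Pcu ** cmat (B_tilde \<mu> \<nu> \<phi> y)) *v W y))"

definition F_minus_fixed_point ::
  "real \<Rightarrow> real \<Rightarrow> (real \<Rightarrow> real) \<Rightarrow> real \<Rightarrow> real \<Rightarrow> nat \<Rightarrow> (real \<Rightarrow> complex^4) \<Rightarrow> bool" where
  "F_minus_fixed_point \<mu> \<nu> \<phi> \<theta> L j W \<longleftrightarrow>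
     W \<in> Linf (- L) \<and> (AE x in lebesgue_on {..-L}. F_minus \<mu> \<nu> \<phi> \<theta> L j W x = W x)"

end

theory Submission
  imports Defs
begin

text \<open>
  The bilinear form \<open>p\<^sub>1 q\<^sub>3 - p\<^sub>3 q\<^sub>1 - p\<^sub>4 q\<^sub>2 + p\<^sub>2 q\<^sub>4\<close> is constant along pairs of solutions
  of \<open>Q' = B(x) Q\<close>, so it vanishes on pairs of solutions that decay at \<open>-\<infinity>\<close>. The functions
  \<open>exp (\<mu>\<^sub>j x) W\<^sub>j(x)\<close> are, after modification on a null set, such solutions. Pairing them at \<open>x\<close> with a
  decaying real solution whose first and fourth components vanish at \<open>x\<close> gives two linear equations
  for the remaining components. Their determinant is the minor of \<open>W\<^sub>1(x), W\<^sub>2(x)\<close> in the first and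
  fourth rows, which is nonzero because \<open>W\<^sub>j(x)\<close> is close to the eigenvector.
\<close>

section \<open>Functional calculus of a diagonalised matrix\<close>

text \<open>A state vector encodes a scalar function u as (u, u'', u''' + 2u', u'). The form is the
  boundary term in Green's formula for the formally self-adjoint operator (1 + d^2/dx^2)^2 -
  f'(\<phi>); hence its invariance. The sandwich plane is u = u' = 0. An arbitrary decaying solution
  is tested against the two constructed ones rather than expanded in them.

  The fixed-point map is assembled from a limit, a series, a definite description and Bochner
  integrals, all total operators; their values become known only through an explicit diagonalisation
  of the limiting matrix and integrability proofs. The fixed-point equation and the norm bound hold
  almost everywhere, while the claim concerns every x: the image of W under the map serves as
  continuous representative.

  Origin of the constant: the eigenvectors have norm at most 2 rho^(1/2), so every component is off
  by less than 1/(4 rho). The minor of the exact eigenvectors has modulus 2 |sin(\<theta>/2)| /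
  rho^(3/2), which exceeds (9/8) / rho^(3/2), and such errors change it by at most (9/8) /
  rho^(3/2).\<close>

definition diag_mat :: "('n::finite \<Rightarrow> complex) \<Rightarrow> complex^'n^'n" where
  "diag_mat d = (\<chi> i j. if i = j then d i else 0)"

lemma diag_mat_mult_vec: "(diag_mat d *v v) $ i = d i * v $ i"
  by (simp add: diag_mat_def matrix_vector_mult_def if_distrib[of "\<lambda>x. x * _"] sum.delta cong: if_cong)

lemma diag_mat_mult: "diag_mat d ** diag_mat e = diag_mat (\<lambda>i. d i * e i)"
  by (simp add: diag_mat_def matrix_matrix_mult_def vec_eq_iff if_distrib[of "\<lambda>x. x * _"] sum.delta cong: if_cong)

lemma diag_mat_one: "diag_mat (\<lambda>i. 1) = mat 1"
  by (simp add: diag_mat_def mat_def vec_eq_iff)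

text \<open>The inner product \<open>T ** S\<close> cancels. The shape
  \<open>S ** diag_mat d ** T\<close> is kept throughout, so that powers, exponentials and
  projections can be read off from \<open>d\<close>.\<close>

lemma conj_diag_mult:
  fixes S T :: "complex^'n^'n"
  assumes "T ** S = mat 1"
  shows "(S ** diag_mat d ** T) ** (S ** diag_mat e ** T) = S ** diag_mat (\<lambda>i. d i * e i) ** T"
proof -
  have "(S ** diag_mat d ** T) ** (S ** diag_mat e ** T) = S ** diag_mat d ** (T ** S) ** diag_mat e ** T"
    by (simp only: matrix_mul_assoc)
  also have "\<dots> = S ** (diag_mat d ** diag_mat e) ** T"
    by (simp add: assms matrix_mul_assoc)
  finally show ?thesis by (simp only: diag_mat_mult)
qed

lemma conj_diag_one:
  fixes S T :: "complex^'n^'n"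
  assumes "T ** S = mat 1"
  shows "S ** diag_mat (\<lambda>i. 1) ** T = mat 1"
  using assms by (simp add: diag_mat_one matrix_left_right_inverse)

lemma mat_pow_conj_diag:
  fixes S T :: "complex^'n^'n"
  assumes "T ** S = mat 1"
  shows "mat_pow (S ** diag_mat d ** T) k = S ** diag_mat (\<lambda>i. d i ^ k) ** T"
proof (induction k)
  case 0
  then show ?case using conj_diag_one[OF assms] by (simp add: mat_pow_def)
next
  case (Suc k)
  then show ?case using conj_diag_mult[OF assms] by (simp add: mat_pow_def)
qed

lemma conj_diag_entry:
  fixes S T :: "complex^'n^'n"
  shows "(S ** diag_mat d ** T) $ a $ b = (\<Sum>i\<in>UNIV. S $ a $ i * d i * T $ i $ b)"
  by (simp add: diag_mat_def matrix_matrix_mult_def if_distrib[of "\<lambda>x. _ * x"] sum.delta cong: if_cong)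

lemma sums_vecI:
  fixes f :: "nat \<Rightarrow> 'a::real_normed_vector^'n"
  assumes "\<And>i. (\<lambda>k. f k $ i) sums (s $ i)"
  shows "f sums s"
  using assms unfolding sums_def by (intro vec_tendstoI) (simp add: sum_component)

text \<open>Each entry of the series is a finite combination of the scalar exponential series of the
  \<open>d i\<close>; their convergence determines the value of the infinite sum.\<close>

lemma mat_exp_conj_diag:
  fixes S T :: "complex^'n^'n"
  assumes "T ** S = mat 1"
  shows "mat_exp (S ** diag_mat d ** T) = S ** diag_mat (\<lambda>i. exp (d i)) ** T"
proof -
  have "(\<lambda>k. (1 / fact k) *\<^sub>R mat_pow (S ** diag_mat d ** T) k) sums (S ** diag_mat (\<lambda>i. exp (d i)) ** T)"
  proof (intro sums_vecI)
    fix a b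
    have "(\<lambda>k. \<Sum>i\<in>UNIV. S $ a $ i * ((d i ^ k) /\<^sub>R fact k) * T $ i $ b) sums (\<Sum>i\<in>UNIV. S $ a $ i * exp (d i) * T $ i $ b)"
      by (intro sums_sum sums_mult sums_mult2 exp_converges)
    then show "(\<lambda>k. ((1 / fact k) *\<^sub>R mat_pow (S ** diag_mat d ** T) k) $ a $ b) sums
        (S ** diag_mat (\<lambda>i. exp (d i)) ** T) $ a $ b"
      by (simp add: mat_pow_conj_diag[OF assms] conj_diag_entry scaleR_sum_right divide_inverse_commute)
  qed
  then show ?thesis
    unfolding mat_exp_def by (rule sums_unique[symmetric])
qed

lemma conj_diag_const:
  fixes S T :: "complex^'n^'n"
  assumes "T ** S = mat 1"
  shows "S ** diag_mat (\<lambda>i. c) ** T = mat c"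
proof -
  have "(S ** diag_mat (\<lambda>i. c) ** T) $ a $ b = c * (S ** T) $ a $ b" for a b
    unfolding conj_diag_entry by (simp add: matrix_matrix_mult_def sum_distrib_left mult_ac)
  moreover have "S ** T = mat 1" using assms by (simp add: matrix_left_right_inverse)
  ultimately show ?thesis by (simp add: vec_eq_iff mat_def)
qed

lemma conj_diag_minus_mat:
  fixes S T :: "complex^'n^'n"
  assumes "T ** S = mat 1"
  shows "S ** diag_mat d ** T - mat c = S ** diag_mat (\<lambda>i. d i - c) ** T"
  unfolding conj_diag_const[OF assms, of c, symmetric]
  by (simp add: vec_eq_iff conj_diag_entry sum_subtractf algebra_simps)

lemma scaleR_conj_diag:
  fixes S T :: "complex^'n^'n"
  shows "r *\<^sub>R (S ** diag_mat d ** T) = S ** diag_mat (\<lambda>i. of_real r * d i) ** T"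
  by (simp add: vec_eq_iff conj_diag_entry scaleR_sum_right) (simp add: scaleR_conv_of_real mult_ac)

lemma conj_diag_mult_vec:
  fixes S T :: "complex^'n^'n"
  shows "(S ** diag_mat d ** T) *v v = (\<Sum>i\<in>UNIV. (d i * (T *v v) $ i) *s column i S)"
  unfolding matrix_vector_mul_assoc[symmetric] matrix_mult_sum[of S] diag_mat_mult_vec ..

lemma conj_diag_mult_vec_coord:
  fixes S T :: "complex^'n^'n"
  assumes "T ** S = mat 1"
  shows "(T *v ((S ** diag_mat d ** T) *v v)) $ i = d i * (T *v v) $ i"
proof -
  have "T *v ((S ** diag_mat d ** T) *v v) = (T ** S) *v (diag_mat d *v (T *v v))"
    by (simp only: matrix_vector_mul_assoc matrix_mul_assoc)
  then show ?thesis by (simp only: assms matrix_vector_mul_lid diag_mat_mult_vec)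
qed

text \<open>In the coordinates \<open>T *v v\<close>, a power of the shifted matrix multiplies entry
  \<open>i\<close> by \<open>(d i - l) ^ k\<close>, which is nonzero whenever
  \<open>l \<in> X\<close> and \<open>d i \<notin> X\<close>. Conversely, a vector is the
  combination of the columns of \<open>S\<close> with these coordinates as coefficients.\<close>

lemma spectral_subspace_conj_diag:
  fixes S T :: "complex^'n^'n"
  assumes TS: "T ** S = mat 1"
  shows "spectral_subspace (S ** diag_mat d ** T) X = {v. \<forall>i. d i \<notin> X \<longrightarrow> (T *v v) $ i = 0}" (is "_ = ?E")
proof
  let ?A = "S ** diag_mat d ** T"
  have pow: "mat_pow (?A - mat l) k = S ** diag_mat (\<lambda>i. (d i - l) ^ k) ** T" for l k
    unfolding conj_diag_minus_mat[OF TS] by (rule mat_pow_conj_diag[OF TS])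
  have "vec.subspace ?E"
    by (auto simp: vec.subspace_def matrix_vector_right_distrib vec.scale)
  moreover have "{v. \<exists>l\<in>X. \<exists>k. mat_pow (?A - mat l) k *v v = 0} \<subseteq> ?E"
  proof clarify
    fix v l k i
    assume "l \<in> X" "mat_pow (?A - mat l) k *v v = 0" "d i \<notin> X"
    then have "(d i - l) ^ k * (T *v v) $ i = 0"
      using conj_diag_mult_vec_coord[OF TS, of "\<lambda>i. (d i - l) ^ k" v i] by (simp add: pow)
    with \<open>l \<in> X\<close> \<open>d i \<notin> X\<close> show "(T *v v) $ i = 0" by auto
  qed
  ultimately show "spectral_subspace ?A X \<subseteq> ?E"
    unfolding spectral_subspace_def by (intro vec.span_minimal)
  show "?E \<subseteq> spectral_subspace ?A X"
  proof clarify
    fix v assume v: "\<forall>i. d i \<notin> X \<longrightarrow> (T *v v) $ i = 0"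
    have "v = (S ** diag_mat (\<lambda>i. 1) ** T) *v v"
      by (simp add: conj_diag_one[OF TS])
    also have "\<dots> = (\<Sum>i\<in>UNIV. (T *v v) $ i *s column i S)"
      by (simp add: conj_diag_mult_vec)
    also have "\<dots> \<in> spectral_subspace ?A X"
      unfolding spectral_subspace_def
    proof (intro vec.span_sum)
      fix i
      show "(T *v v) $ i *s column i S \<in> vec.span {v. \<exists>l\<in>X. \<exists>k. mat_pow (?A - mat l) k *v v = 0}"
      proof (cases "d i \<in> X")
        case True
        have "(T *v column i S) $ j = (if i = j then 1 else 0)" for j
        proof -
          have "(T *v column i S) $ j = (T ** S) $ j $ i"
            by (simp add: column_def matrix_vector_mult_def matrix_matrix_mult_def)
          then show ?thesis by (auto simp: TS mat_def)
        qed
        \<comment> \<open>Exponent 1 suffices, since the columns of \<open>S\<close> are genuine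
          eigenvectors.\<close>
        then have "mat_pow (?A - mat (d i)) 1 *v column i S = 0"
          unfolding pow conj_diag_mult_vec by (intro sum.neutral) auto
        with True show ?thesis
          by (intro vec.span_scale vec.span_base) blast
      qed (simp add: v vec.span_zero)
    qed
    finally show "v \<in> spectral_subspace ?A X" .
  qed
qed

text \<open>\<open>v - P *v v\<close> lies in the common kernel and \<open>P *v v\<close> in the
  common range, where \<open>Q\<close> acts as the identity. This is the uniqueness required by the
  definite description in \<open>spectral_projection\<close>.\<close>

lemma idempotent_eqI:
  fixes P Q :: "complex^'n^'n"
  assumes P: "P ** P = P" and Q: "Q ** Q = Q"
    and r: "range ((*v) P) = range ((*v) Q)"
    and k: "{v. P *v v = 0} = {v. Q *v v = 0}"
  shows "P = Q"
proof -
  have "P *v v = Q *v v" for v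
  proof -
    have "P *v (v - P *v v) = 0"
      by (simp add: matrix_vector_mult_diff_distrib matrix_vector_mul_assoc P)
    then have "Q *v (v - P *v v) = 0" using k by blast
    then have "Q *v v = Q *v (P *v v)" by (simp add: matrix_vector_mult_diff_distrib)
    moreover obtain w where "P *v v = Q *v w" using r by (metis rangeE rangeI)
    ultimately show ?thesis by (simp add: matrix_vector_mul_assoc Q)
  qed
  then show ?thesis by (simp add: matrix_eq)
qed

lemma spectral_projection_conj_diag:
  fixes S T :: "complex^'n^'n"
  assumes TS: "T ** S = mat 1"
  shows "spectral_projection (S ** diag_mat d ** T) X = S ** diag_mat (\<lambda>i. if d i \<in> X then 1 else 0) ** T"
    (is "_ = ?P")
proof -
  have idem: "?P ** ?P = ?P"
    by (simp add: conj_diag_mult[OF TS] if_distrib cong: if_cong)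
  have T_inj: "v = 0 \<longleftrightarrow> (\<forall>i. (T *v v) $ i = 0)" for v
  proof
    assume "\<forall>i. (T *v v) $ i = 0"
    then have "T *v v = 0" by (simp add: vec_eq_iff)
    then have "(S ** T) *v v = 0"
      by (simp flip: matrix_vector_mul_assoc)
    then show "v = 0" using TS by (simp add: matrix_left_right_inverse)
  qed simp
  have coord: "(T *v (?P *v v)) $ i = (if d i \<in> X then (T *v v) $ i else 0)" for v i
    by (simp add: conj_diag_mult_vec_coord[OF TS])
  have ker: "{v. ?P *v v = 0} = {v. \<forall>i. d i \<notin> - X \<longrightarrow> (T *v v) $ i = 0}"
    by (subst T_inj) (auto simp: coord)
  have "?P *v v = v" if "\<forall>i. d i \<notin> X \<longrightarrow> (T *v v) $ i = 0" for v
  proof -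
    have "?P *v v - v = 0"
      using that by (subst T_inj) (simp add: matrix_vector_mult_diff_distrib coord)
    then show ?thesis by simp
  qed
  then have ran: "range ((*v) ?P) = {v. \<forall>i. d i \<notin> X \<longrightarrow> (T *v v) $ i = 0}"
  proof (intro set_eqI iffI)
    fix x assume "x \<in> {v. \<forall>i. d i \<notin> X \<longrightarrow> (T *v v) $ i = 0}"
    then have "x = ?P *v x" using \<open>\<And>v. _ \<Longrightarrow> ?P *v v = v\<close> by simp
    then show "x \<in> range ((*v) ?P)" by (rule range_eqI)
  qed (auto simp: coord)
  \<comment> \<open>\<open>R\<close> and \<open>K\<close> are generic so that range and kernel can
    be supplied in the coordinate form of \<open>ran\<close> and \<open>ker\<close>, the form to
    which the spectral subspaces unfold.\<close>
  have "(THE P. P ** P = P \<and> range ((*v) P) = R \<and> {v. P *v v = 0} = K) = ?P"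
    if "R = range ((*v) ?P)" "K = {v. ?P *v v = 0}" for R K
    unfolding that
  proof (rule the_equality)
    fix P assume "P ** P = P \<and> range ((*v) P) = range ((*v) ?P) \<and> {v. P *v v = 0} = {v. ?P *v v = 0}"
    then show "P = ?P" using idempotent_eqI[of P ?P] idem by blast
  qed (simp add: idem)
  from this[OF ran[symmetric] ker[symmetric]] show ?thesis
    unfolding spectral_projection_def spectral_subspace_conj_diag[OF TS] .
qed

section \<open>Eigenbasis of the limiting matrix\<close>

lemma vector_4:
  "(vector [a, b, c, d] :: 'a::zero^4) $ 1 = a"
  "(vector [a, b, c, d] :: 'a::zero^4) $ 2 = b"
  "(vector [a, b, c, d] :: 'a::zero^4) $ 3 = c"
  "(vector [a, b, c, d] :: 'a::zero^4) $ 4 = d"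
  unfolding vector_def by simp_all

text \<open>The state vector at 0 of u(x) = exp(l x) / l^2; the scaling makes the second component
  1, as in the given eigenvectors.\<close>

definition eigvec :: "complex \<Rightarrow> complex^4" where
  "eigvec l = vector [1 / l\<^sup>2, 1, l + 2 / l, 1 / l]"

text \<open>A left eigenvector for \<open>l\<close> is obtained by pairing with \<open>eigvec (- l)\<close> in the invariant
  bilinear form above; the factor normalises its product with \<open>eigvec l\<close>.\<close>

definition eigcovec :: "complex \<Rightarrow> complex^4" where
  "eigcovec l = (l ^ 3 / (4 * (l\<^sup>2 + 1))) *s vector [l + 2 / l, 1 / l, 1 / l\<^sup>2, 1]"

text \<open>The spectrum is symmetric under sign change because the limiting equation is invariant
  under reflection of x; the first two positions are meant for the unstable eigenvalues.\<close>

definition eigval :: "complex \<Rightarrow> complex \<Rightarrow> 4 \<Rightarrow> complex" where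
  "eigval m1 m2 i = vector [m1, m2, - m1, - m2] $ i"

definition eigbasis :: "complex \<Rightarrow> complex \<Rightarrow> complex^4^4" where
  "eigbasis m1 m2 = (\<chi> a i. eigvec (eigval m1 m2 i) $ a)"

definition eigcobasis :: "complex \<Rightarrow> complex \<Rightarrow> complex^4^4" where
  "eigcobasis m1 m2 = (\<chi> i. eigcovec (eigval m1 m2 i))"

lemma column_eigbasis: "column i (eigbasis m1 m2) = eigvec (eigval m1 m2 i)"
  by (simp add: column_def eigbasis_def)

lemma eigcovec_pairing:
  assumes "l \<noteq> 0" "k \<noteq> 0" "l\<^sup>2 \<noteq> -1"
  shows "(\<Sum>a\<in>UNIV. eigcovec l $ a * eigvec k $ a)
    = l ^ 3 / (4 * (l\<^sup>2 + 1)) * ((l + 2 / l) / k\<^sup>2 + 1 / l + (k + 2 / k) / l\<^sup>2 + 1 / k)"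
  by (simp add: sum_4 eigcovec_def eigvec_def vector_4 algebra_simps)

text \<open>Before normalisation the pairing is \<open>4 * (l\<^sup>2 + 1) / l ^ 3\<close>. As
  \<open>4 * l * (l\<^sup>2 + 1)\<close> is the derivative of the characteristic polynomial, the
  hypotheses express that an eigenvalue \<open>l\<close> is a simple root.\<close>

lemma eigcovec_self:
  assumes "l \<noteq> 0" "l\<^sup>2 \<noteq> -1"
  shows "(\<Sum>a\<in>UNIV. eigcovec l $ a * eigvec l $ a) = 1"
proof -
  have l1: "l\<^sup>2 + 1 \<noteq> 0" using assms by (metis add_eq_0_iff2)
  have "(l + 2 / l) / l\<^sup>2 + 1 / l + (l + 2 / l) / l\<^sup>2 + 1 / l = 4 * (l\<^sup>2 + 1) / l ^ 3"
    using assms by (simp add: field_simps power2_eq_square power3_eq_cube)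
  then have "(\<Sum>a\<in>UNIV. eigcovec l $ a * eigvec l $ a) = l ^ 3 / (4 * (l\<^sup>2 + 1)) * (4 * (l\<^sup>2 + 1) / l ^ 3)"
    using assms by (simp only: eigcovec_pairing[OF assms(1) assms(1) assms(2)])
  also have "\<dots> = 1" using assms(1) l1 by (simp del: distrib_left_numeral)
  finally show ?thesis .
qed

text \<open>Up to a factor this pairs \<open>eigvec (- l)\<close> with itself in an alternating
  form.\<close>

lemma eigcovec_uminus:
  assumes "l \<noteq> 0" "l\<^sup>2 \<noteq> -1"
  shows "(\<Sum>a\<in>UNIV. eigcovec l $ a * eigvec (- l) $ a) = 0"
  using assms by (simp add: eigcovec_pairing add_divide_distrib diff_divide_distrib)

text \<open>Since \<open>l\<^sup>2 + 2 = - k\<^sup>2\<close> and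
  \<open>k\<^sup>2 + 2 = - l\<^sup>2\<close>, the four terms of the pairing cancel in two
  pairs.\<close>

lemma eigcovec_other:
  assumes "l \<noteq> 0" "k \<noteq> 0" "l\<^sup>2 \<noteq> -1" "l\<^sup>2 + k\<^sup>2 = -2"
  shows "(\<Sum>a\<in>UNIV. eigcovec l $ a * eigvec k $ a) = 0"
proof -
  have l: "l\<^sup>2 + 2 = - k\<^sup>2" and k: "k\<^sup>2 + 2 = - l\<^sup>2" using assms(4) by (simp_all add: algebra_simps eq_neg_iff_add_eq_0)
  have "(l + 2 / l) / k\<^sup>2 + 1 / l = ((l\<^sup>2 + 2) / k\<^sup>2 + 1) / l"
    using assms by (simp add: field_simps power2_eq_square)
  moreover have "(k + 2 / k) / l\<^sup>2 + 1 / k = ((k\<^sup>2 + 2) / l\<^sup>2 + 1) / k"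
    using assms by (simp add: field_simps power2_eq_square)
  ultimately have "(l + 2 / l) / k\<^sup>2 + 1 / l + ((k + 2 / k) / l\<^sup>2 + 1 / k) = 0"
    using assms unfolding l k by simp
  then show ?thesis using assms by (simp add: eigcovec_pairing add.assoc)
qed

lemma eigcobasis_eigbasis:
  assumes "m1 \<noteq> 0" "m2 \<noteq> 0" "m1\<^sup>2 \<noteq> -1" "m1\<^sup>2 + m2\<^sup>2 = -2"
  shows "eigcobasis m1 m2 ** eigbasis m1 m2 = mat 1"
proof -
  have m2: "m2\<^sup>2 \<noteq> -1"
  proof
    assume "m2\<^sup>2 = -1"
    with assms(4) have "(m1\<^sup>2 - 1) = -2" by simp
    then have "m1\<^sup>2 + 1 = 0" by (simp add: diff_eq_eq)
    then have "m1\<^sup>2 = -1" by (simp add: eq_neg_iff_add_eq_0)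
    with assms(3) show False ..
  qed
  have "(eigcobasis m1 m2 ** eigbasis m1 m2) $ i $ k
      = (\<Sum>a\<in>UNIV. eigcovec (eigval m1 m2 i) $ a * eigvec (eigval m1 m2 k) $ a)" for i k
    by (simp add: matrix_matrix_mult_def eigcobasis_def eigbasis_def)
  moreover have "(\<Sum>a\<in>UNIV. eigcovec (eigval m1 m2 i) $ a * eigvec (eigval m1 m2 k) $ a)
      = (if i = k then 1 else 0)" for i k
    using exhaust_4[of i] exhaust_4[of k] assms m2 eigcovec_uminus[of "- m1"] eigcovec_uminus[of "- m2"]
    by (elim disjE) (simp_all add: eigval_def vector_4 eigcovec_self eigcovec_uminus eigcovec_other add.commute)
  ultimately show ?thesis by (simp add: vec_eq_iff mat_def)
qed

section \<open>The limiting matrix, its diagonalisation and the remainder\<close>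

lemma deriv_nonlin: "deriv (nonlin \<mu> \<nu>) u = 2 * \<nu> * u - 3 * u\<^sup>2 - \<mu>"
  unfolding nonlin_def by (rule DERIV_imp_deriv) (auto intro!: derivative_eq_intros)

lemma B_inf_eq:
  assumes "(\<phi> \<longlongrightarrow> 0) at_infinity"
  shows "B_inf \<mu> \<nu> \<phi> =
     vector [vector [0, 0, 0, 1], vector [0, 0, 1, -2], vector [-1 - \<mu>, 0, 0, 0], vector [0, 1, 0, 0]]"
    (is "_ = ?M")
proof -
  have "((\<lambda>x. -1 + (2 * \<nu> * \<phi> x - 3 * (\<phi> x)\<^sup>2 - \<mu>)) \<longlongrightarrow> -1 + (2 * \<nu> * 0 - 3 * 0\<^sup>2 - \<mu>)) at_infinity"
    by (intro tendsto_intros assms)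
  then have lim31: "((\<lambda>x. -1 + deriv (nonlin \<mu> \<nu>) (\<phi> x)) \<longlongrightarrow> -1 - \<mu>) at_infinity"
    by (simp add: deriv_nonlin)
  have "(B_mat \<mu> \<nu> \<phi> \<longlongrightarrow> ?M) at_infinity"
  proof (intro vec_tendstoI)
    fix a b :: 4
    show "((\<lambda>x. B_mat \<mu> \<nu> \<phi> x $ a $ b) \<longlongrightarrow> ?M $ a $ b) at_infinity"
      using exhaust_4[of a] exhaust_4[of b] lim31
      by (elim disjE) (simp_all add: B_mat_def vector_4)
  qed
  then show ?thesis
    unfolding B_inf_def by (intro tendsto_Lim) (simp add: trivial_limit_at_infinity)
qed

text \<open>This is f'(\<phi>(x)) - f'(0), the only entry of \<open>B_tilde\<close> that does not
  vanish identically; it stands in row 3, column 1.\<close>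

definition b_tilde :: "real \<Rightarrow> (real \<Rightarrow> real) \<Rightarrow> real \<Rightarrow> real" where
  "b_tilde \<nu> \<phi> x = 2 * \<nu> * \<phi> x - 3 * (\<phi> x)\<^sup>2"

lemma B_tilde_mult_vec:
  assumes "(\<phi> \<longlongrightarrow> 0) at_infinity"
  shows "cmat (B_tilde \<mu> \<nu> \<phi> x) *v w = vector [0, 0, b_tilde \<nu> \<phi> x * w $ 1, 0]"
  by (simp add: vec_eq_iff forall_4 matrix_vector_mult_def sum_4 vector_4 B_tilde_def B_inf_eq[OF assms]
      B_mat_def deriv_nonlin b_tilde_def)

text \<open>Rows 1, 2 and 4 hold for every nonzero \<open>l\<close>; row 3 is the characteristic
  equation.\<close>

lemma B_inf_eigvec:
  assumes "(\<phi> \<longlongrightarrow> 0) at_infinity" "l \<noteq> 0" "l ^ 4 + 2 * l\<^sup>2 + 1 + of_real \<mu> = 0"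
  shows "cmat (B_inf \<mu> \<nu> \<phi>) *v eigvec l = l *s eigvec l"
proof -
  have "(- 1 - complex_of_real \<mu>) = l ^ 4 + 2 * l\<^sup>2 - (l ^ 4 + 2 * l\<^sup>2 + 1 + of_real \<mu>)"
    by simp
  then have "(- 1 - complex_of_real \<mu>) = l ^ 4 + 2 * l\<^sup>2"
    by (simp only: assms(3) diff_zero)
  then have "(- 1 - complex_of_real \<mu>) / l\<^sup>2 = l * (l + 2 / l)"
    using assms(2) by (simp add: field_simps power2_eq_square eval_nat_numeral)
  then show ?thesis using assms(2)
    by (simp add: vec_eq_iff forall_4 matrix_vector_mult_def sum_4 vector_4 B_inf_eq[OF assms(1)]
      eigvec_def power2_eq_square)
qed

text \<open>By Vieta, \<open>m1\<^sup>2\<close> and \<open>m2\<^sup>2\<close> are the roots of z^2 +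
  2 z + 1 + \<mu>; they are distinct because neither is -1.\<close>

lemma B_inf_conj_diag:
  assumes "(\<phi> \<longlongrightarrow> 0) at_infinity" "m1 \<noteq> 0" "m2 \<noteq> 0" "m1\<^sup>2 + m2\<^sup>2 = -2" "m1\<^sup>2 * m2\<^sup>2 = 1 + of_real \<mu>"
    "m1\<^sup>2 \<noteq> -1"
  shows "cmat (B_inf \<mu> \<nu> \<phi>) = eigbasis m1 m2 ** diag_mat (eigval m1 m2) ** eigcobasis m1 m2"
proof -
  have m2: "m2\<^sup>2 = -2 - m1\<^sup>2" using assms(4) by (simp add: algebra_simps)
  have mu: "of_real \<mu> = m1\<^sup>2 * m2\<^sup>2 - 1" using assms(5) by simp
  have p1: "m1 ^ 4 + 2 * m1\<^sup>2 + 1 + of_real \<mu> = 0"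
    unfolding mu m2 by (simp add: algebra_simps power2_eq_square power4_eq_xxxx)
  have m1: "m1\<^sup>2 = -2 - m2\<^sup>2" using assms(4) by (simp add: algebra_simps)
  have p2: "m2 ^ 4 + 2 * m2\<^sup>2 + 1 + of_real \<mu> = 0"
    unfolding mu m1 by (simp add: algebra_simps power2_eq_square power4_eq_xxxx)
  have ev: "cmat (B_inf \<mu> \<nu> \<phi>) *v eigvec (eigval m1 m2 i) = eigval m1 m2 i *s eigvec (eigval m1 m2 i)" for i
    using exhaust_4[of i] assms p1 p2
    by (elim disjE; intro B_inf_eigvec) (simp_all add: eigval_def vector_4)
  have "cmat (B_inf \<mu> \<nu> \<phi>) ** eigbasis m1 m2 = eigbasis m1 m2 ** diag_mat (eigval m1 m2)"
  proof -
    have "(cmat (B_inf \<mu> \<nu> \<phi>) ** eigbasis m1 m2) $ a $ i = (cmat (B_inf \<mu> \<nu> \<phi>) *v eigvec (eigval m1 m2 i)) $ a" for a i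
      by (simp add: matrix_matrix_mult_def matrix_vector_mult_def eigbasis_def)
    moreover have "(eigbasis m1 m2 ** diag_mat (eigval m1 m2)) $ a $ i = (eigval m1 m2 i *s eigvec (eigval m1 m2 i)) $ a" for a i
      by (simp add: matrix_matrix_mult_def diag_mat_def eigbasis_def if_distrib[of "\<lambda>x. _ * x"] sum.delta cong: if_cong)
    ultimately show ?thesis by (simp add: vec_eq_iff ev)
  qed
  then show ?thesis
    using matrix_mul_assoc[of "cmat (B_inf \<mu> \<nu> \<phi>)" "eigbasis m1 m2" "eigcobasis m1 m2"]
      eigcobasis_eigbasis[of m1 m2] assms
    by (simp add: matrix_left_right_inverse)
qed

section \<open>Fixed points give solutions\<close>

lemma set_integrable_mult_bounded:
  fixes g c :: "real \<Rightarrow> complex"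
  assumes S: "S \<subseteq> {..b}" "S \<in> sets lebesgue"
    and g: "set_integrable lebesgue S g"
    and c: "c \<in> borel_measurable (lebesgue_on {..b})" "AE y in lebesgue_on {..b}. norm (c y) \<le> M"
  shows "set_integrable lebesgue S (\<lambda>y. g y * c y)"
proof -
  have "integrable (lebesgue_on S) (\<lambda>y. g y * c y)"
  proof (rule Bochner_Integration.integrable_bound)
    show gi: "integrable (lebesgue_on S) (\<lambda>y. of_real M * g y)"
      using S g by (intro integrable_mult_right) (simp add: set_integrable_eq)
    have "integrable (lebesgue_on S) g" using S g by (simp add: set_integrable_eq)
    moreover have "c \<in> borel_measurable (lebesgue_on S)"
      using c(1) S(1) by (rule measurable_restrict_mono)
    ultimately show "(\<lambda>y. g y * c y) \<in> borel_measurable (lebesgue_on S)"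
      by (intro borel_measurable_times) auto
    have "AE y in lebesgue. y \<in> {..b} \<longrightarrow> norm (c y) \<le> M"
      using c(2) by (subst (asm) AE_restrict_space_iff) auto
    then have "AE y in lebesgue. y \<in> S \<longrightarrow> norm (g y * c y) \<le> norm (of_real M * g y)"
    proof eventually_elim
      case (elim y)
      show ?case
      proof
        assume "y \<in> S"
        then have "norm (c y) \<le> \<bar>M\<bar>" using elim S by fastforce
        then show "norm (g y * c y) \<le> norm (of_real M * g y)"
          by (simp add: norm_mult mult.commute mult_right_mono)
      qed
    qed
    then show "AE y in lebesgue_on S. norm (g y * c y) \<le> norm (of_real M * g y)"
      using S by (subst AE_restrict_space_iff) auto
  qed
  then show ?thesis using S by (simp add: set_integrable_eq)
qed

text \<open>The modulus \<open>exp (- y * Re l)\<close> decays as y tends to minus infinity. This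
  makes the stable part of the fixed-point map converge for coefficients that are merely
  bounded.\<close>

lemma set_integrable_exp_Iic:
  fixes l :: complex
  assumes "Re l < 0"
  shows "set_integrable lebesgue {..b} (\<lambda>y. exp (- (of_real y * l)))"
proof -
  have "(\<lambda>x. exp (- (- Re l) * x)) integrable_on {- b..}"
    using assms by (intro integrable_on_exp_minus_to_infinity) simp
  then have "(\<lambda>x. exp (- (- Re l) * x)) absolutely_integrable_on {- b..}"
    by (intro nonnegative_absolutely_integrable_1) auto
  then have "set_integrable lebesgue {..b} (\<lambda>x. exp (- Re l * x))"
    using has_absolute_integral_reflect_real[of "{..b}" "{- b..}" "\<lambda>x. exp (Re l * x)"]
    by (auto simp: image_uminus_atLeast image_uminus_atMost)
  then show ?thesis
  proof (rule set_integrable_bound)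
    show "set_borel_measurable lebesgue {..b} (\<lambda>y. exp (- (of_real y * l)))"
      unfolding set_borel_measurable_def
      by (intro borel_measurable_scaleR borel_measurable_indicator measurable_completion borel_measurable_continuous_onI continuous_intros) auto
  qed (auto simp: norm_exp_eq_Re mult.commute)
qed

lemma set_integrable_exp_Icc:
  fixes l :: complex
  shows "set_integrable lebesgue {a..b} (\<lambda>y. exp (- (of_real y * l)))"
  by (intro absolutely_integrable_continuous_real continuous_intros)

lemma bounded_linear_vector_scalar_mult_left: "bounded_linear (\<lambda>c::complex. c *s (v :: complex^'n))"
  by (intro linear_conv_bounded_linear[THEN iffD1] linearI)
     (simp_all add: vec_eq_iff algebra_simps)

text \<open>Integrability of each coefficient is assumed because a non-integrable one would
  contribute the default value 0.\<close>

lemma set_integral_sum_vector_scalar_mult: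
  fixes f :: "'i \<Rightarrow> real \<Rightarrow> complex" and v :: "'i \<Rightarrow> complex^'n"
  assumes "\<And>i. i \<in> I \<Longrightarrow> set_integrable lebesgue S (f i)"
  shows "(LINT y:S|lebesgue. \<Sum>i\<in>I. f i y *s v i) = (\<Sum>i\<in>I. (LINT y:S|lebesgue. f i y) *s v i)"
proof -
  have "has_bochner_integral lebesgue (\<lambda>y. \<Sum>i\<in>I. (indicator S y *\<^sub>R f i y) *s v i)
      (\<Sum>i\<in>I. (LINT y:S|lebesgue. f i y) *s v i)"
    using assms unfolding set_integrable_def set_lebesgue_integral_def
    by (intro has_bochner_integral_sum has_bochner_integral_bounded_linear[OF bounded_linear_vector_scalar_mult_left]
        has_bochner_integral_integrable)
  moreover have "(\<Sum>i\<in>I. (indicator S y *\<^sub>R f i y) *s v i) = indicator S y *\<^sub>R (\<Sum>i\<in>I. f i y *s v i)" for y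
    by (auto simp: indicator_def)
  ultimately show ?thesis
    unfolding set_lebesgue_integral_def by (simp add: has_bochner_integral_integral_eq)
qed

lemma set_integral_Iic_split:
  fixes h :: "real \<Rightarrow> complex"
  assumes "set_integrable lebesgue {..b} h" "x \<le> b"
  shows "(LINT y:{..x}|lebesgue. h y) = (LINT y:{..b}|lebesgue. h y) - integral {x..b} h"
proof -
  have 1: "set_integrable lebesgue {..x} h" and 2: "set_integrable lebesgue {x..b} h"
    using assms by (auto intro: set_integrable_subset)
  have "{..b} = {..x} \<union> {x..b}" using assms(2) by auto
  moreover have "{..x} \<inter> {x..b} = {x}" using assms(2) by auto
  ultimately have "integral {..b} h = integral {..x} h + integral {x..b} h"
    using set_lebesgue_integral_eq_integral(1)[OF 1] set_lebesgue_integral_eq_integral(1)[OF 2]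
    by (simp add: integral_Un)
  then show ?thesis
    using set_lebesgue_integral_eq_integral(2)[OF 1] set_lebesgue_integral_eq_integral(2)[OF assms(1)] by simp
qed

text \<open>Both integrals of the fixed-point map reduce to integrals over \<open>{x..b}\<close>: in the stable
  directions, \<open>K i\<close> is the integral over the whole half line, in the neutral ones it is \<open>0\<close>.\<close>

lemma fixed_point_map_coordinates:
  fixes S T :: "complex^'n^'n" and W :: "real \<Rightarrow> complex^'n" and G :: "real \<Rightarrow> complex^'n^'n"
  assumes TS: "T ** S = mat 1"
    and d: "\<And>i. Re (d i) \<le> 0"
    and c: "\<And>i. (\<lambda>y. (T *v (G y *v W y)) $ i) \<in> borel_measurable (lebesgue_on {..b})"
      "\<And>i. AE y in lebesgue_on {..b}. norm ((T *v (G y *v W y)) $ i) \<le> M i"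
  defines "A \<equiv> S ** diag_mat d ** T"
  obtains K where
    "\<And>i a. (\<lambda>y. exp (- (of_real y * d i)) * (T *v (G y *v W y)) $ i) integrable_on {a..b}"
    "\<And>x. x \<le> b \<Longrightarrow>
       (LINT y:{..x}|lebesgue. (mat_exp ((x - y) *\<^sub>R A) ** spectral_projection A {z. Re z < 0} ** G y) *v W y)
       - (LINT y:{x..b}|lebesgue. (mat_exp ((x - y) *\<^sub>R A) ** spectral_projection A {z. Re z = 0} ** G y) *v W y)
       = (\<Sum>i\<in>UNIV. (exp (of_real x * d i) *
            (K i - integral {x..b} (\<lambda>y. exp (- (of_real y * d i)) * (T *v (G y *v W y)) $ i))) *s column i S)"
proof -
  define c where "c i y = (T *v (G y *v W y)) $ i" for i y
  define h where "h i y = exp (- (of_real y * d i)) * c i y" for i y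
  have h_Icc: "set_integrable lebesgue {x..b} (h i)" for i x
    unfolding h_def c_def
    by (rule set_integrable_mult_bounded[OF _ _ set_integrable_exp_Icc c]) auto
  have h_Iic: "set_integrable lebesgue {..b} (h i)" if "Re (d i) < 0" for i
    unfolding h_def c_def
    by (rule set_integrable_mult_bounded[OF _ _ set_integrable_exp_Iic[OF that] c]) auto
  have integrand: "(mat_exp ((x - y) *\<^sub>R A) ** spectral_projection A X ** G y) *v W y
      = (\<Sum>i\<in>UNIV. (if d i \<in> X then exp (of_real x * d i) * h i y else 0) *s column i S)" for x y X
  proof -
    \<comment> \<open>Separating x from y leaves an integrand \<open>h i\<close> independent of x,
      so that x enters the integrals only through their limits.\<close>
    have "exp (of_real (x - y) * d i) = exp (of_real x * d i) * exp (- (of_real y * d i))" for i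
      by (simp add: left_diff_distrib exp_diff exp_minus divide_inverse)
    then have "(exp (of_real (x - y) * d i) * (if d i \<in> X then 1 else 0)) * c i y
        = (if d i \<in> X then exp (of_real x * d i) * h i y else 0)" for i
      by (simp add: h_def)
    moreover have "(mat_exp ((x - y) *\<^sub>R A) ** spectral_projection A X ** G y) *v W y
        = (mat_exp ((x - y) *\<^sub>R A) ** spectral_projection A X) *v (G y *v W y)"
      by (simp add: matrix_vector_mul_assoc matrix_mul_assoc)
    moreover have "mat_exp ((x - y) *\<^sub>R A) ** spectral_projection A X
        = S ** diag_mat (\<lambda>i. exp (of_real (x - y) * d i) * (if d i \<in> X then 1 else 0)) ** T"
      unfolding A_def scaleR_conj_diag mat_exp_conj_diag[OF TS] spectral_projection_conj_diag[OF TS]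
        conj_diag_mult[OF TS] ..
    ultimately show ?thesis
      by (simp only: conj_diag_mult_vec c_def)
  qed
  define K where "K i = (if Re (d i) < 0 then LINT y:{..b}|lebesgue. h i y else 0)" for i
  show ?thesis
  proof (rule that[of K])
    fix i a
    show "(\<lambda>y. exp (- (of_real y * d i)) * (T *v (G y *v W y)) $ i) integrable_on {a..b}"
      using set_lebesgue_integral_eq_integral(1)[OF h_Icc] by (simp add: h_def[abs_def] c_def)
  next
    fix x assume x: "x \<le> b"
    have i1: "set_integrable lebesgue {..x} (\<lambda>y. if d i \<in> {z. Re z < 0} then exp (of_real x * d i) * h i y else 0)" for i
    proof (cases "Re (d i) < 0")
      case True
      then show ?thesis
        using x by (simp add: set_integrable_subset[OF h_Iic[OF True]])
    qed (simp add: set_integrable_def)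
    have i2: "set_integrable lebesgue {x..b} (\<lambda>y. if d i \<in> {z. Re z = 0} then exp (of_real x * d i) * h i y else 0)" for i
    proof (cases "Re (d i) = 0")
      case True
      then show ?thesis by (simp add: h_Icc)
    qed (simp add: set_integrable_def)
    have coeff: "(LINT y:{..x}|lebesgue. (if d i \<in> {z. Re z < 0} then exp (of_real x * d i) * h i y else 0))
        - (LINT y:{x..b}|lebesgue. (if d i \<in> {z. Re z = 0} then exp (of_real x * d i) * h i y else 0))
        = exp (of_real x * d i) * (K i - integral {x..b} (h i))" for i
    proof (cases "Re (d i) < 0")
      case True
      then show ?thesis
        using set_integral_Iic_split[OF h_Iic[OF True] x] by (simp add: K_def)
    next
      case False
      with d[of i] have "Re (d i) = 0" by simp
      then show ?thesis
        using set_lebesgue_integral_eq_integral(2)[OF h_Icc, of x i] by (simp add: K_def)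
    qed
    show "(LINT y:{..x}|lebesgue. (mat_exp ((x - y) *\<^sub>R A) ** spectral_projection A {z. Re z < 0} ** G y) *v W y)
       - (LINT y:{x..b}|lebesgue. (mat_exp ((x - y) *\<^sub>R A) ** spectral_projection A {z. Re z = 0} ** G y) *v W y)
       = (\<Sum>i\<in>UNIV. (exp (of_real x * d i) *
            (K i - integral {x..b} (\<lambda>y. exp (- (of_real y * d i)) * (T *v (G y *v W y)) $ i))) *s column i S)"
      unfolding integrand
      apply (subst set_integral_sum_vector_scalar_mult, rule i1)
      apply (subst set_integral_sum_vector_scalar_mult, rule i2)
      apply (simp only: sum_subtractf[symmetric] vec.scale_left_diff_distrib[symmetric] coeff)
      apply (simp add: h_def[abs_def] c_def)
      done
  qed
qed

lemma norm_matrix_vector_mult_nth_le: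
  fixes T :: "complex^'n^'m"
  shows "norm ((T *v v) $ i) \<le> (\<Sum>k\<in>UNIV. norm (T $ i $ k)) * norm v"
proof -
  have "norm ((T *v v) $ i) \<le> (\<Sum>k\<in>UNIV. norm (T $ i $ k * v $ k))"
    by (simp add: matrix_vector_mult_def norm_sum)
  also have "\<dots> \<le> (\<Sum>k\<in>UNIV. norm (T $ i $ k) * norm v)"
    by (intro sum_mono) (simp add: norm_mult mult_left_mono Finite_Cartesian_Product.norm_nth_le)
  finally show ?thesis by (simp add: sum_distrib_right)
qed

text \<open>In coordinates, \<open>F\<close> is built from exponentials and indefinite integrals,
  hence continuous, and it agrees with \<open>W\<close> almost everywhere. Replacing
  \<open>W\<close> by \<open>F\<close> under the integrals makes the integrands continuous, so the
  fundamental theorem of calculus yields the equation; the factor \<open>exp (of_real x * m)\<close>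
  undoes the spectral shift by \<open>m\<close>.\<close>

lemma fixed_point_solution:
  fixes S T :: "complex^'n^'n" and W F :: "real \<Rightarrow> complex^'n" and G :: "real \<Rightarrow> complex^'n^'n"
  assumes TS: "T ** S = mat 1"
    and d: "\<And>i. Re (d i) \<le> 0" and dj: "d j = 0"
    and G: "\<And>i k. continuous_on UNIV (\<lambda>y. G y $ i $ k)"
      "\<And>y w. y \<le> b \<Longrightarrow> norm (G y *v w) \<le> M * norm w"
    and W: "W \<in> borel_measurable (lebesgue_on {..b})"
      "AE y in lebesgue_on {..b}. norm (W y - column j S) \<le> \<delta>"
    and fp: "AE x in lebesgue_on {..b}. F x = W x"
  defines "A \<equiv> S ** diag_mat d ** T"
  assumes F: "\<And>x. F x = column j S
      + (LINT y:{..x}|lebesgue. (mat_exp ((x - y) *\<^sub>R A) ** spectral_projection A {z. Re z < 0} ** G y) *v W y)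
      - (LINT y:{x..b}|lebesgue. (mat_exp ((x - y) *\<^sub>R A) ** spectral_projection A {z. Re z = 0} ** G y) *v W y)"
  shows "x \<le> b \<Longrightarrow> norm (F x - column j S) \<le> \<delta>"
    and "x \<in> {a..b} \<Longrightarrow> ((\<lambda>x. exp (of_real x * m) *s F x) has_vector_derivative
          (S ** diag_mat (\<lambda>i. d i + m) ** T + G x) *v (exp (of_real x * m) *s F x)) (at x within {a..b})"
proof -
  \<comment> \<open>The function stays a parameter because both \<open>W\<close> and its continuous
    representative \<open>F\<close> are inserted.\<close>
  define c where "c W i y = (T *v (G y *v W y)) $ i" for W :: "real \<Rightarrow> complex^'n" and i y
  have normW: "AE y in lebesgue_on {..b}. norm (W y) \<le> norm (column j S) + \<delta>"
    using W(2) by eventually_elim norm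
  have meas: "c W i \<in> borel_measurable (lebesgue_on {..b})" for i
  proof -
    have "(\<lambda>y. G y $ k $ l) \<in> borel_measurable (lebesgue_on {..b})" for k l
      by (intro continuous_imp_measurable_on_sets_lebesgue continuous_on_subset[OF G(1)]) auto
    moreover have "(\<lambda>y. W y $ l) \<in> borel_measurable (lebesgue_on {..b})" for l
      by (intro measurable_compose[OF W(1) borel_measurable_continuous_onI] continuous_intros)
    ultimately show ?thesis
      unfolding c_def matrix_vector_mult_def by simp
  qed
  have bnd: "AE y in lebesgue_on {..b}. norm (c W i y)
      \<le> (\<Sum>k\<in>UNIV. norm (T $ i $ k)) * (\<bar>M\<bar> * (norm (column j S) + \<delta>))" for i
    using normW AE_space
  proof eventually_elim
    case (elim y)
    then have "norm (G y *v W y) \<le> M * norm (W y)" by (intro G(2)) simp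
    also have "\<dots> \<le> \<bar>M\<bar> * (norm (column j S) + \<delta>)" using elim by (intro mult_mono) auto
    finally show ?case
      unfolding c_def
      by (intro order_trans[OF norm_matrix_vector_mult_nth_le] mult_left_mono sum_nonneg) auto
  qed
  define h where "h W i y = exp (- (of_real y * d i)) * c W i y" for W i y
  obtain K where hint: "\<And>i a. h W i integrable_on {a..b}"
    and K: "\<And>x. x \<le> b \<Longrightarrow>
       (LINT y:{..x}|lebesgue. (mat_exp ((x - y) *\<^sub>R A) ** spectral_projection A {z. Re z < 0} ** G y) *v W y)
       - (LINT y:{x..b}|lebesgue. (mat_exp ((x - y) *\<^sub>R A) ** spectral_projection A {z. Re z = 0} ** G y) *v W y)
       = (\<Sum>i\<in>UNIV. (exp (of_real x * d i) * (K i - integral {x..b} (h W i))) *s column i S)"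
    using fixed_point_map_coordinates[where d = d, OF TS d meas[unfolded c_def] bnd[unfolded c_def],
        folded A_def c_def, folded h_def] by blast
  have F_eq: "F x = column j S + (\<Sum>i\<in>UNIV. (exp (of_real x * d i) * (K i - integral {x..b} (h W i))) *s column i S)"
    if "x \<le> b" for x
    using F[of x] K[OF that] by simp
  note bl = bounded_linear_vector_scalar_mult_left
  have F_cont: "continuous_on {a..b} F" for a
  proof -
    have "continuous_on {a..b} (\<lambda>x. column j S + (\<Sum>i\<in>UNIV. (exp (of_real x * d i) * (K i - integral {x..b} (h W i))) *s column i S))"
      by (intro continuous_intros bounded_linear.continuous_on[OF bl] indefinite_integral_continuous_1' hint)
    then show ?thesis by (rule continuous_on_eq) (simp add: F_eq)
  qed
  show "norm (F x - column j S) \<le> \<delta>" if "x \<le> b" for x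
  proof -
    \<comment> \<open>The window reaches below \<open>x\<close> so that \<open>x\<close> is in the
      closure of the open interval even when \<open>x = b\<close>; a closed set that contains almost
      every point of that interval contains its closure.\<close>
    define C where "C = {y \<in> {x - 1..b}. norm (F y - column j S) \<le> \<delta>}"
    have "closed C"
      unfolding C_def by (intro continuous_on_closed_Collect_le continuous_intros F_cont)
    have "AE y in lebesgue_on {..b}. norm (F y - column j S) \<le> \<delta>"
      using W(2) fp by eventually_elim simp
    then have "AE y in lebesgue. y \<in> {..b} \<longrightarrow> norm (F y - column j S) \<le> \<delta>"
      by (subst (asm) AE_restrict_space_iff) auto
    then have "AE y\<in>{x - 1<..<b} in lebesgue. y \<in> C"
      by eventually_elim (auto simp: C_def)
    then have "{x - 1<..<b} \<subseteq> C"
      using mem_closed_if_AE_lebesgue_open[OF open_greaterThanLessThan \<open>closed C\<close>] by blast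
    then have "closure {x - 1<..<b} \<subseteq> C" using \<open>closed C\<close> by (rule closure_minimal)
    then have "x \<in> C" using that by auto
    then show ?thesis by (simp add: C_def)
  qed
  show "((\<lambda>x. exp (of_real x * m) *s F x) has_vector_derivative
          (S ** diag_mat (\<lambda>i. d i + m) ** T + G x) *v (exp (of_real x * m) *s F x)) (at x within {a..b})"
    if x: "x \<in> {a..b}" for x a
  proof -
    have "AE y in lebesgue. y \<in> {..b} \<longrightarrow> F y = W y"
      using fp by (subst (asm) AE_restrict_space_iff) auto
    then obtain N where N: "negligible N" "\<And>y. y \<le> b \<Longrightarrow> y \<notin> N \<Longrightarrow> F y = W y"
      by (auto simp: eventually_ae_filter negligible_iff_null_sets)
    have hF: "integral {y..b} (h F i) = integral {y..b} (h W i)" for y i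
      by (rule integral_spike[OF N(1)]) (simp add: h_def c_def N(2))
    have cont: "continuous_on {a..b} (h F i)" for i
      unfolding h_def[abs_def] c_def[abs_def] matrix_vector_mult_def
      by (auto intro!: continuous_intros continuous_on_subset[OF G(1)] F_cont)
    \<comment> \<open>Coordinate \<open>i\<close> of \<open>exp (of_real y * m) *s F y\<close>. The
      Kronecker term accounts for the constant vector \<open>column j S\<close>; its exponential
      factor is harmless because \<open>d j = 0\<close>.\<close>
    define p where "p i y = exp (of_real y * (d i + m)) * ((if i = j then 1 else 0) + K i - integral {y..b} (h F i))" for i y
    have Fp: "exp (of_real y * m) *s F y = (\<Sum>i\<in>UNIV. p i y *s column i S)" if "y \<le> b" for y
    proof -
      have col: "column j S = (\<Sum>i\<in>UNIV. (exp (of_real y * d i) * (if i = j then 1 else 0)) *s column i S)"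
      proof -
        have "(exp (of_real y * d i) * (if i = j then 1 else 0)) *s column i S = (if i = j then column i S else 0)" for i
          using dj by simp
        then show ?thesis by (simp add: sum.delta)
      qed
      have "F y = (\<Sum>i\<in>UNIV. (exp (of_real y * d i) * (if i = j then 1 else 0)) *s column i S)
          + (\<Sum>i\<in>UNIV. (exp (of_real y * d i) * (K i - integral {y..b} (h F i))) *s column i S)"
        unfolding F_eq[OF that] hF by (rule arg_cong2[where f = "(+)", OF col refl])
      also have "\<dots> = (\<Sum>i\<in>UNIV. (exp (of_real y * d i) * ((if i = j then 1 else 0) + K i - integral {y..b} (h F i))) *s column i S)"
        by (simp only: sum.distrib[symmetric] vec.scale_left_distrib[symmetric] distrib_left[symmetric] add_diff_eq)
      finally have "F y = (\<Sum>i\<in>UNIV. (exp (of_real y * d i) * ((if i = j then 1 else 0) + K i - integral {y..b} (h F i))) *s column i S)" .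
      then show ?thesis
        by (simp add: vec.scale_sum_right p_def distrib_left exp_add mult_ac)
    qed
    have coord: "(T *v (\<Sum>i\<in>UNIV. q i *s column i S)) $ k = q k" for q k
    proof -
      have "(\<Sum>i\<in>UNIV. q i *s column i S) = S *v (\<chi> i. q i)" by (simp add: matrix_mult_sum)
      then show ?thesis using TS by (simp add: matrix_vector_mul_assoc)
    qed
    have dp: "(p i has_vector_derivative (d i + m) * p i x + exp (of_real x * m) * c F i x) (at x within {a..b})" for i
    proof -
      have "((\<lambda>y. integral {y..b} (h F i)) has_vector_derivative - h F i x) (at x within {a..b})"
        using integral_has_vector_derivative'[OF cont x] .
      moreover have "((\<lambda>y. exp (of_real y * (d i + m))) has_vector_derivative (d i + m) * exp (of_real x * (d i + m))) (at x within {a..b})"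
        by (auto intro!: derivative_eq_intros has_vector_derivative_real_field simp: mult.commute)
      ultimately have "(p i has_vector_derivative
          exp (of_real x * (d i + m)) * (0 - - h F i x)
          + (d i + m) * exp (of_real x * (d i + m)) * ((if i = j then 1 else 0) + K i - integral {x..b} (h F i))) (at x within {a..b})"
        unfolding p_def[abs_def]
        by (intro has_vector_derivative_mult has_vector_derivative_diff has_vector_derivative_const)
      moreover have "exp (of_real x * (d i + m)) * h F i x = exp (of_real x * m) * c F i x"
        by (simp add: h_def distrib_left exp_add exp_minus)
      ultimately show ?thesis by (simp add: p_def mult_ac add.commute)
    qed
    have "((\<lambda>y. \<Sum>i\<in>UNIV. p i y *s column i S) has_vector_derivative
        (\<Sum>i\<in>UNIV. ((d i + m) * p i x + exp (of_real x * m) * c F i x) *s column i S)) (at x within {a..b})"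
      by (intro has_vector_derivative_sum bounded_linear.has_vector_derivative[OF bl] dp)
    moreover have "(\<Sum>i\<in>UNIV. ((d i + m) * p i x + exp (of_real x * m) * c F i x) *s column i S)
        = (S ** diag_mat (\<lambda>i. d i + m) ** T + G x) *v (exp (of_real x * m) *s F x)" (is "?L = _")
    proof -
      have "S ** diag_mat (\<lambda>i. d i + m) ** T *v (exp (of_real x * m) *s F x)
          = (\<Sum>i\<in>UNIV. ((d i + m) * p i x) *s column i S)"
        using x by (simp add: conj_diag_mult_vec Fp coord)
      moreover have "G x *v (exp (of_real x * m) *s F x) = (\<Sum>i\<in>UNIV. (exp (of_real x * m) * c F i x) *s column i S)"
      proof -
        have "G x *v F x = (S ** diag_mat (\<lambda>i. 1) ** T) *v (G x *v F x)"
          by (simp add: conj_diag_one[OF TS])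
        also have "\<dots> = (\<Sum>i\<in>UNIV. c F i x *s column i S)"
          by (simp add: conj_diag_mult_vec c_def)
        finally show ?thesis by (simp add: vec.scale vec.scale_sum_right)
      qed
      ultimately show ?thesis
        by (simp add: matrix_vector_mult_add_rdistrib vec.scale_left_distrib sum.distrib)
    qed
    ultimately have "((\<lambda>y. \<Sum>i\<in>UNIV. p i y *s column i S) has_vector_derivative
        (S ** diag_mat (\<lambda>i. d i + m) ** T + G x) *v (exp (of_real x * m) *s F x)) (at x within {a..b})"
      by simp
    then show ?thesis
      by (rule has_vector_derivative_transform[OF x, rotated]) (simp add: Fp)
  qed
qed

section \<open>Isotropy of decaying solutions and the nonvanishing minor\<close>

text \<open>The symplectic form with conjugate pairs (1, 3) and (2, 4), extended complex
  bilinearly.\<close>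

definition sympl :: "complex^4 \<Rightarrow> complex^4 \<Rightarrow> complex" where
  "sympl p q = p $ 1 * q $ 3 - p $ 3 * q $ 1 - p $ 4 * q $ 2 + p $ 2 * q $ 4"

text \<open>The x-dependent entry of the matrix contributes \<open>P y $ 1 * Q y $ 1\<close> once
  with each sign; the terms with constant coefficients cancel likewise.\<close>

lemma sympl_solutions_constant:
  assumes P: "\<And>y. y \<in> {a..b} \<Longrightarrow> (P has_vector_derivative cmat (B_mat \<mu> \<nu> \<phi> y) *v P y) (at y within {a..b})"
    and Q: "\<And>y. y \<in> {a..b} \<Longrightarrow> (Q has_vector_derivative cmat (B_mat \<mu> \<nu> \<phi> y) *v Q y) (at y within {a..b})"
    and "x \<in> {a..b}"
  shows "sympl (P x) (Q x) = sympl (P a) (Q a)"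
proof -
  have "((\<lambda>y. sympl (P y) (Q y)) has_vector_derivative 0) (at y within {a..b})" if y: "y \<in> {a..b}" for y
  proof -
    let ?B = "cmat (B_mat \<mu> \<nu> \<phi> y)"
    have m: "((\<lambda>y. P y $ i * Q y $ k) has_vector_derivative
        P y $ i * (?B *v Q y) $ k + (?B *v P y) $ i * Q y $ k) (at y within {a..b})" for i k
      by (intro has_vector_derivative_mult bounded_linear.has_vector_derivative[OF bounded_linear_vec_nth] P[OF y] Q[OF y])
    show ?thesis
      unfolding sympl_def
      by (rule has_vector_derivative_eq_rhs[OF has_vector_derivative_add[OF has_vector_derivative_diff[OF
            has_vector_derivative_diff[OF m[of 1 3] m[of 3 1]] m[of 4 2]] m[of 2 4]]])
        (simp add: matrix_vector_mult_def sum_4 B_mat_def vector_4 algebra_simps)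
  qed
  then obtain k where "\<And>y. y \<in> {a..b} \<Longrightarrow> sympl (P y) (Q y) = k"
    by (rule has_vector_derivative_zero_constant[OF convex_real_interval(5)]) auto
  then show ?thesis using assms(3) by auto
qed

lemma sympl_decaying_solutions:
  assumes P: "\<And>a y. y \<in> {a..b} \<Longrightarrow> (P has_vector_derivative cmat (B_mat \<mu> \<nu> \<phi> y) *v P y) (at y within {a..b})"
    and Q: "\<And>a y. y \<in> {a..b} \<Longrightarrow> (Q has_vector_derivative cmat (B_mat \<mu> \<nu> \<phi> y) *v Q y) (at y within {a..b})"
    and lim: "(P \<longlongrightarrow> 0) at_bot" "(Q \<longlongrightarrow> 0) at_bot"
    and x: "x \<le> b"
  shows "sympl (P x) (Q x) = 0"
proof -
  have "((\<lambda>y. sympl (P y) (Q y)) \<longlongrightarrow> sympl 0 0) at_bot"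
    unfolding sympl_def by (intro tendsto_intros lim)
  moreover have "\<forall>\<^sub>F y in at_bot. sympl (P y) (Q y) = sympl (P x) (Q x)"
    using sympl_solutions_constant[OF P Q, of _ x] x
    by (intro eventually_at_bot_linorderI[of x]) simp
  ultimately have "((\<lambda>y::real. sympl (P x) (Q x)) \<longlongrightarrow> sympl 0 0) at_bot"
    by (rule Lim_transform_eventually)
  then have "sympl (P x) (Q x) = sympl 0 0" by (simp add: tendsto_const_iff)
  then show ?thesis by (simp add: sympl_def)
qed

lemma complexify_solution:
  assumes "(Q has_vector_derivative B *v Q y) (at y)"
  shows "((\<lambda>y. \<chi> i. complex_of_real (Q y $ i)) has_vector_derivative
    cmat B *v (\<chi> i. complex_of_real (Q y $ i))) (at y within X)"
proof -
  have "bounded_linear (\<lambda>v::real^'n. \<chi> i. complex_of_real (v $ i))"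
    by (intro linear_conv_bounded_linear[THEN iffD1] linearI)
       (simp_all add: vec_eq_iff, simp add: scaleR_conv_of_real)
  from bounded_linear.has_vector_derivative[OF this assms] 
  have "((\<lambda>y. \<chi> i. complex_of_real (Q y $ i)) has_vector_derivative (\<chi> i. complex_of_real ((B *v Q y) $ i))) (at y)" .
  moreover have "(\<chi> i. complex_of_real ((B *v Q y) $ i)) = cmat B *v (\<chi> i. complex_of_real (Q y $ i))"
    by (simp add: vec_eq_iff matrix_vector_mult_def)
  ultimately show ?thesis by (simp add: has_vector_derivative_at_within)
qed

section \<open>Explicit eigenvalues, eigenvectors and their perturbed minor\<close>

lemma cos_sin_of_tan:
  assumes "\<mu> > 0" "pi / 2 < \<theta>" "\<theta> < pi" "tan \<theta> = - sqrt \<mu>"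
  shows "cos \<theta> = - 1 / rho \<mu>" "sin \<theta> = sqrt \<mu> / rho \<mu>"
proof -
  \<comment> \<open>The tangent determines the angle only modulo pi; the second quadrant selects the
    negative root below.\<close>
  have c: "cos \<theta> < 0" using cos_monotone_0_pi[of "pi / 2" \<theta>] assms by simp
  have "sin \<theta> / cos \<theta> * cos \<theta> = - sqrt \<mu> * cos \<theta>" using assms(4) by (simp only: tan_def)
  then have sin: "sin \<theta> = - sqrt \<mu> * cos \<theta>" using c by simp
  have "(sin \<theta>)\<^sup>2 = \<mu> * (cos \<theta>)\<^sup>2"
    unfolding sin using assms(1) by (simp add: power_mult_distrib)
  then have "(cos \<theta>)\<^sup>2 * (1 + \<mu>) = 1"
    using sin_cos_squared_add[of \<theta>] by (simp add: algebra_simps)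
  then have "(cos \<theta>)\<^sup>2 = 1 / (1 + \<mu>)" using assms(1) by (simp add: eq_divide_eq)
  moreover have "(1 / rho \<mu>)\<^sup>2 = 1 / (1 + \<mu>)"
    using assms(1) by (simp add: rho_def power_divide)
  ultimately have "(- cos \<theta>)\<^sup>2 = (1 / rho \<mu>)\<^sup>2" by simp
  moreover have "0 \<le> 1 / rho \<mu>" using assms(1) by (simp add: rho_def)
  ultimately have "- cos \<theta> = 1 / rho \<mu>"
    using c power2_eq_iff_nonneg[of "- cos \<theta>" "1 / rho \<mu>"] by simp
  then show cos: "cos \<theta> = - 1 / rho \<mu>" by simp
  show "sin \<theta> = sqrt \<mu> / rho \<mu>" using sin by (simp add: cos)
qed

text \<open>The point -1 + i sqrt(\<mu>) has modulus rho and argument \<theta>. It solves (z + 1)^2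
  = -\<mu>, the characteristic equation in z = l^2.\<close>

lemma mu_u_squared:
  assumes "\<mu> > 0" "pi / 2 < \<theta>" "\<theta> < pi" "tan \<theta> = - sqrt \<mu>"
  shows "(mu_u (rho \<mu>) \<theta> 1)\<^sup>2 = Complex (-1) (sqrt \<mu>)"
proof -
  have "rho \<mu> > 0" using assms by (simp add: rho_def)
  then have "(mu_u (rho \<mu>) \<theta> 1)\<^sup>2 = of_real (rho \<mu>) * (exp (\<i> * of_real (\<theta> / 2)))\<^sup>2"
    by (simp add: mu_u_def power_mult_distrib flip: of_real_power)
  also have "(exp (\<i> * of_real (\<theta> / 2)))\<^sup>2 = cis \<theta>"
    by (simp add: cis_conv_exp flip: exp_double)
  finally show ?thesis
    using cos_sin_of_tan[OF assms] \<open>rho \<mu> > 0\<close> by (simp add: complex_eq_iff)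
qed

lemma mu_u_2: "mu_u r \<theta> 2 = cnj (mu_u r \<theta> 1)"
  by (simp add: mu_u_def exp_cnj)

lemma cnj_eigvec: "(\<chi> i. cnj (eigvec l $ i)) = eigvec (cnj l)"
  by (simp add: vec_eq_iff forall_4 eigvec_def vector_4)

lemma V1_u_eq_eigvec:
  assumes "r > 0"
  shows "V1_u r \<theta> = eigvec (mu_u r \<theta> 1)"
proof -
  define R E where "R = complex_of_real (sqrt r)" and "E = exp (\<i> * of_real (\<theta> / 2))"
  have "exp (- \<i> * of_real (\<theta> / 2)) = 1 / E"
    unfolding E_def mult_minus_left exp_minus by (rule inverse_eq_divide)
  moreover have "E\<^sup>2 = exp (\<i> * of_real \<theta>)"
    by (simp add: E_def flip: exp_double)
  then have "exp (- \<i> * of_real \<theta>) = 1 / E\<^sup>2"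
    unfolding mult_minus_left exp_minus by (simp only: inverse_eq_divide)
  moreover have "complex_of_real r = R\<^sup>2" using assms by (simp add: R_def flip: of_real_power)
  ultimately have "V1_u r \<theta> = vector [1 / R\<^sup>2 * (1 / E\<^sup>2), 1, R * E + 2 / R * (1 / E), 1 / R * (1 / E)]"
    unfolding V1_u_def R_def[symmetric] E_def[symmetric] by (simp only:)
  also have "\<dots> = eigvec (R * E)"
    by (simp add: eigvec_def power_mult_distrib)
  finally show ?thesis by (simp add: mu_u_def R_def E_def)
qed

lemma V_u_eq_eigvec:
  assumes "r > 0" "j \<in> {1, 2}"
  shows "V_u r \<theta> j = eigvec (mu_u r \<theta> j)"
  using assms mu_u_2[of r \<theta>] by (auto simp: V_u_def V1_u_eq_eigvec cnj_eigvec)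

lemma norm_mu_u:
  assumes "r > 0"
  shows "norm (mu_u r \<theta> 1) = sqrt r"
  using assms by (simp add: mu_u_def norm_mult)

text \<open>With r = sqrt(rho) the components have moduli 1/r^2, 1, r and 1/r; the sum of squares is
  at most 2 + 2 r^2, hence at most 4 r^2.\<close>

lemma norm_V_u_le:
  assumes "\<mu> > 0" "pi / 2 < \<theta>" "\<theta> < pi" "tan \<theta> = - sqrt \<mu>" "j \<in> {1, 2}"
  shows "norm (V_u (rho \<mu>) \<theta> j) \<le> 2 * sqrt (rho \<mu>)"
proof -
  define r where "r = sqrt (rho \<mu>)"
  define l where "l = mu_u (rho \<mu>) \<theta> 1"
  have rho: "rho \<mu> \<ge> 1" and r: "r \<ge> 1" using assms(1) by (auto simp: rho_def r_def)
  have l: "norm l = r" using rho norm_mu_u[of "rho \<mu>" \<theta>] by (simp add: l_def r_def)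
  then have l0: "l \<noteq> 0" using r by auto
  \<comment> \<open>This is minus the conjugate of \<open>l\<^sup>2\<close>, so it has the same
    modulus; that bounds the third component.\<close>
  have "l\<^sup>2 + 2 = Complex 1 (sqrt \<mu>)"
    using mu_u_squared[OF assms(1-4)] by (simp add: l_def complex_eq_iff)
  then have "norm (l\<^sup>2 + 2) = r\<^sup>2"
    using assms(1) rho by (simp add: cmod_def rho_def r_def)
  moreover have "l + 2 / l = (l\<^sup>2 + 2) / l" using l0 by (simp add: field_simps power2_eq_square)
  ultimately have l3: "norm (l + 2 / l) = r"
    using l r by (simp add: norm_divide power2_eq_square)
  have "(norm (eigvec l))\<^sup>2 = (1 / r\<^sup>2)\<^sup>2 + 1 + r\<^sup>2 + (1 / r)\<^sup>2"
    by (simp add: norm_vec_def L2_set_def sum_4 eigvec_def vector_4 l l3 norm_divide norm_power)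
  also have "\<dots> \<le> 1 + r\<^sup>2 + r\<^sup>2 + 1"
    using r by (intro add_mono) (auto simp: power_le_one_iff intro: order_trans[OF _ one_le_power])
  also have "\<dots> \<le> (2 * r)\<^sup>2" using r one_le_power[of r 2] by (simp add: power_mult_distrib)
  finally have "norm (eigvec l) \<le> 2 * r" using r by (intro power2_le_imp_le[of "norm (eigvec l)"]) simp_all
  moreover have "norm (V_u (rho \<mu>) \<theta> j) = norm (eigvec l)"
    using assms(5) rho by (auto simp: V_u_def V1_u_eq_eigvec l_def norm_vec_def)
  ultimately show ?thesis by (simp add: r_def)
qed

text \<open>For the eigenvectors the minor is \<open>(e - cnj e) / r ^ 3\<close> with
  \<open>e\<close> as below. If the perturbed minor vanished, this number would equal a sum of error
  terms that is too small.\<close>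

lemma minor_nonzero:
  fixes w z :: "complex^4"
  assumes mu: "\<mu> > 0" "pi / 2 < \<theta>" "\<theta> < pi" "tan \<theta> = - sqrt \<mu>"
    and w: "norm (w - V_u (rho \<mu>) \<theta> 1) \<le> \<delta>" and z: "norm (z - V_u (rho \<mu>) \<theta> 2) \<le> \<delta>"
    and \<delta>: "\<delta> < 1 / (4 * rho \<mu>)"
  shows "w $ 1 * z $ 4 \<noteq> w $ 4 * z $ 1"
proof
  assume eq: "w $ 1 * z $ 4 = w $ 4 * z $ 1"
  define r where "r = sqrt (rho \<mu>)"
  define e where "e = exp (- \<i> * of_real (\<theta> / 2))"
  define v1 v4 where "v1 = 1 / of_real (r\<^sup>2) * e\<^sup>2" and "v4 = 1 / of_real r * e"
  have rho: "rho \<mu> \<ge> 1" and r: "r \<ge> 1" using mu(1) by (auto simp: rho_def r_def)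
  have r2: "r\<^sup>2 = rho \<mu>" using rho by (simp add: r_def)
  have e: "norm e = 1" by (simp add: e_def)
  have e2: "e\<^sup>2 = exp (- \<i> * of_real \<theta>)" by (simp add: e_def flip: exp_double)
  have V: "V_u (rho \<mu>) \<theta> 1 $ 1 = v1" "V_u (rho \<mu>) \<theta> 1 $ 4 = v4"
    "V_u (rho \<mu>) \<theta> 2 $ 1 = cnj v1" "V_u (rho \<mu>) \<theta> 2 $ 4 = cnj v4"
    using e2 r2 by (simp_all add: V_u_def V1_u_def vector_4 v1_def v4_def r_def e_def)
  have ecnj: "e * cnj e = 1" using e complex_norm_square[of e] by simp
  have "v1 * cnj v4 - v4 * cnj v1 = of_real (1 / r ^ 3) * (e * (e * cnj e) - cnj e * (e * cnj e))"
    using r by (simp add: v1_def v4_def power2_eq_square power3_eq_cube diff_divide_distrib mult_ac right_diff_distrib)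
  also have "\<dots> = of_real (1 / r ^ 3) * (e - cnj e)" by (simp only: ecnj mult_1_right)
  also have "norm \<dots> = 2 * \<bar>Im e\<bar> / r ^ 3"
    using r by (simp add: complex_diff_cnj norm_mult norm_divide norm_power)
  also have "\<bar>Im e\<bar> = \<bar>sin (\<theta> / 2)\<bar>"
    by (simp add: e_def Im_exp)
  finally have main: "norm (v1 * cnj v4 - v4 * cnj v1) = 2 * \<bar>sin (\<theta> / 2)\<bar> / r ^ 3" .
  have "(sin (\<theta> / 2))\<^sup>2 = (1 + 1 / rho \<mu>) / 2"
    using cos_double_sin[of "\<theta> / 2"] cos_sin_of_tan(1)[OF mu] by simp
  \<comment> \<open>The threshold 9/16 is half of the 9/8 coming from the error estimate, and its
    square is below 1/2.\<close>
  then have "1 / 2 < (sin (\<theta> / 2))\<^sup>2" using rho by simp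
  then have "(9 / 16)\<^sup>2 < \<bar>sin (\<theta> / 2)\<bar>\<^sup>2"
    by (simp add: power_divide)
  then have sin: "9 / 16 < \<bar>sin (\<theta> / 2)\<bar>" by (rule power2_less_imp_less) simp
  define a b c d where "a = w $ 1 - v1" and "b = w $ 4 - v4" and "c = z $ 1 - cnj v1" and "d = z $ 4 - cnj v4"
  have bds: "norm a \<le> \<delta>" "norm b \<le> \<delta>" "norm c \<le> \<delta>" "norm d \<le> \<delta>"
    using order_trans[OF Finite_Cartesian_Product.norm_nth_le w, of 1] order_trans[OF Finite_Cartesian_Product.norm_nth_le w, of 4]
      order_trans[OF Finite_Cartesian_Product.norm_nth_le z, of 1] order_trans[OF Finite_Cartesian_Product.norm_nth_le z, of 4]
    by (simp_all add: a_def b_def c_def d_def V V[unfolded One_nat_def])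
  have d0: "0 \<le> \<delta>" using bds(1) norm_ge_zero order_trans by blast
  have n1: "norm v1 = 1 / r\<^sup>2" and n4: "norm v4 = 1 / r"
    using r by (simp_all add: v1_def v4_def norm_mult norm_divide norm_power e)
  have "v1 * cnj v4 - v4 * cnj v1 = (v4 * c + b * cnj v1 + b * c) - (v1 * d + a * cnj v4 + a * d)"
    using eq by (simp add: a_def b_def c_def d_def algebra_simps)
  also have "norm \<dots> \<le> (norm v4 * norm c + norm b * norm v1 + norm b * norm c)
      + (norm v1 * norm d + norm a * norm v4 + norm a * norm d)"
  proof -
    have "norm (p * q + r * cnj s + t) \<le> norm p * norm q + norm r * norm s + norm t" for p q r s t :: complex
      using norm_triangle_ineq[of "p * q + r * cnj s" t] norm_triangle_ineq[of "p * q" "r * cnj s"]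
      by (simp add: norm_mult)
    from this[of v4 c b v1 "b * c"] this[of v1 d a v4 "a * d"] show ?thesis
      by (intro order_trans[OF norm_triangle_ineq4] add_mono) (simp_all add: norm_mult)
  qed
  also have "\<dots> \<le> (1 / r * \<delta> + \<delta> * (1 / r\<^sup>2) + \<delta> * \<delta>) + (1 / r\<^sup>2 * \<delta> + \<delta> * (1 / r) + \<delta> * \<delta>)"
    unfolding n1 n4 using r d0 bds by (intro add_mono mult_mono) auto
  also have "\<dots> = 2 * \<delta> * (1 / r + 1 / r\<^sup>2 + \<delta>)" by (simp add: algebra_simps)
  \<comment> \<open>The bound \<open>1 / (4 * r\<^sup>2)\<close> is used for the outer
    \<open>\<delta>\<close> and its weakening \<open>1 / (4 * r)\<close> for the inner one; the
    bracket becomes 9/4 times 1/r.\<close>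
  also have "\<dots> \<le> 2 * (1 / (4 * r\<^sup>2)) * (1 / r + 1 / r + 1 / (4 * r))"
  proof -
    have "1 / r\<^sup>2 \<le> 1 / r" using r by (simp add: power2_eq_square field_simps)
    moreover have "\<delta> \<le> 1 / (4 * r\<^sup>2)" using \<delta> r2 by simp
    moreover from calculation have "1 / (4 * r\<^sup>2) \<le> 1 / (4 * r)" by simp
    ultimately have "1 / r + 1 / r\<^sup>2 + \<delta> \<le> 1 / r + 1 / r + 1 / (4 * r)" "2 * \<delta> \<le> 2 * (1 / (4 * r\<^sup>2))"
      by linarith+
    then show ?thesis using d0 r by (intro mult_mono) simp_all
  qed
  also have "\<dots> = 9 / 8 / r ^ 3" using r by (simp add: field_simps power2_eq_square power3_eq_cube)
  also have "\<dots> < 2 * \<bar>sin (\<theta> / 2)\<bar> / r ^ 3" using r sin by (intro divide_strict_right_mono) auto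
  finally show False using main by simp
qed

section \<open>Application to the pulse and conclusion\<close>

lemma b_tilde_bounded:
  assumes "continuous_on UNIV \<phi>" "(\<phi> \<longlongrightarrow> 0) at_infinity"
  obtains M where "\<And>x. \<bar>b_tilde \<nu> \<phi> x\<bar> \<le> M"
proof -
  have lim: "(b_tilde \<nu> \<phi> \<longlongrightarrow> 2 * \<nu> * 0 - 3 * 0\<^sup>2) at_infinity"
    unfolding b_tilde_def[abs_def] by (intro tendsto_intros assms)
  then have "\<forall>\<^sub>F x in at_infinity. \<bar>b_tilde \<nu> \<phi> x\<bar> < 1"
    using tendstoD[OF lim, of 1] by (simp add: dist_real_def)
  then obtain N where N: "\<And>x. N \<le> norm x \<Longrightarrow> \<bar>b_tilde \<nu> \<phi> x\<bar> < 1"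
    by (auto simp: eventually_at_infinity)
  have "compact (b_tilde \<nu> \<phi> ` cball 0 N)"
    unfolding b_tilde_def[abs_def]
    by (intro compact_continuous_image continuous_intros continuous_on_subset[OF assms(1)]) auto
  then have "\<exists>K. \<forall>x\<in>cball 0 N. \<bar>b_tilde \<nu> \<phi> x\<bar> \<le> K"
    by (auto dest!: compact_imp_bounded simp: bounded_iff)
  then obtain K where K: "\<And>x. x \<in> cball 0 N \<Longrightarrow> \<bar>b_tilde \<nu> \<phi> x\<bar> \<le> K" by blast
  show thesis
  proof (rule that[of "max K 1"])
    fix x show "\<bar>b_tilde \<nu> \<phi> x\<bar> \<le> max K 1"
      using N[of x] K[of x] by (cases "N \<le> norm x") auto
  qed
qed

text \<open>The two unstable eigenvalues are conjugate, so shifting by either makes both their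
  directions neutral and the other two stable. Decay at minus infinity comes from
  \<open>exp (x * Re m)\<close> times a bounded factor.\<close>

lemma fixed_point_decaying_solution:
  assumes mu: "\<mu> > 0" "pi / 2 < \<theta>" "\<theta> < pi" "tan \<theta> = - sqrt \<mu>"
    and "pulse \<mu> \<nu> \<phi>" and j: "j \<in> {1, 2}"
    and fp: "F_minus_fixed_point \<mu> \<nu> \<phi> \<theta> L j W"
    and \<delta>: "Linf_norm (- L) (\<lambda>x. W x - V_u (rho \<mu>) \<theta> j) \<le> ereal \<delta>"
  obtains F where
    "\<And>x. x \<le> - L \<Longrightarrow> norm (F x - V_u (rho \<mu>) \<theta> j) \<le> \<delta>"
    "\<And>a x. x \<in> {a..- L} \<Longrightarrow> ((\<lambda>x. exp (of_real x * mu_u (rho \<mu>) \<theta> j) *s F x) has_vector_derivative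
        cmat (B_mat \<mu> \<nu> \<phi> x) *v (exp (of_real x * mu_u (rho \<mu>) \<theta> j) *s F x)) (at x within {a..- L})"
    "((\<lambda>x. exp (of_real x * mu_u (rho \<mu>) \<theta> j) *s F x) \<longlongrightarrow> 0) at_bot"
proof -
  define m1 m2 m where "m1 = mu_u (rho \<mu>) \<theta> 1" and "m2 = mu_u (rho \<mu>) \<theta> 2" and "m = mu_u (rho \<mu>) \<theta> j"
  define d where "d i = eigval m1 m2 i - m" for i
  define j' :: 4 where "j' = (if j = 1 then 1 else 2)"
  define F where "F = F_minus \<mu> \<nu> \<phi> \<theta> L j W"
  have rho: "rho \<mu> > 0" using mu by (simp add: rho_def)
  have lim: "(\<phi> \<longlongrightarrow> 0) at_infinity" using assms(5) by (simp add: pulse_def)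
  have "\<phi> differentiable (at x)" for x
  proof -
    have "\<forall>k<4. \<forall>x. (deriv ^^ k) \<phi> differentiable (at x)"
      using assms(5) unfolding pulse_def by blast
    from this[rule_format, of 0] show ?thesis by simp
  qed
  then have cont: "continuous_on UNIV \<phi>"
    by (auto intro!: continuous_at_imp_continuous_on differentiable_imp_continuous_within)
  have m1sq: "m1\<^sup>2 = Complex (- 1) (sqrt \<mu>)" unfolding m1_def by (rule mu_u_squared[OF mu])
  have m2: "m2 = cnj m1" unfolding m1_def m2_def by (rule mu_u_2)
  have m2sq: "m2\<^sup>2 = Complex (- 1) (- sqrt \<mu>)"
    unfolding m2 complex_cnj_power[symmetric] m1sq by (simp add: complex_eq_iff)
  have ne: "m1 \<noteq> 0" "m2 \<noteq> 0" "m1\<^sup>2 \<noteq> -1"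
    using m1sq mu(1) by (auto simp: m2 complex_eq_iff)
  have sum: "m1\<^sup>2 + m2\<^sup>2 = -2" and prod: "m1\<^sup>2 * m2\<^sup>2 = 1 + of_real \<mu>"
    using mu(1) by (simp_all add: m1sq m2sq complex_eq_iff)
  have Re_m1: "Re m1 > 0"
  proof -
    have "cos (\<theta> / 2) > 0" using mu by (intro cos_gt_zero) auto
    then show ?thesis using rho by (simp add: m1_def mu_u_def Re_exp)
  qed
  have m: "m = m1 \<or> m = m2" and col: "eigval m1 m2 j' = m"
    using j by (auto simp: m_def m1_def m2_def j'_def eigval_def vector_4)
  have Re_m: "Re m = Re m1" using m by (auto simp: m2)
  note TS = eigcobasis_eigbasis[OF ne sum]
  have V: "V_u (rho \<mu>) \<theta> j = column j' (eigbasis m1 m2)"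
    unfolding column_eigbasis col m_def by (rule V_u_eq_eigvec[OF rho j])
  obtain M where M: "\<And>x. \<bar>b_tilde \<nu> \<phi> x\<bar> \<le> M" using b_tilde_bounded[OF cont lim] by blast
  have G1: "continuous_on UNIV (\<lambda>y. cmat (B_tilde \<mu> \<nu> \<phi> y) $ i $ k)" for i k
  proof -
    have "cmat (B_tilde \<mu> \<nu> \<phi> y) $ i $ k = (if i = 3 \<and> k = 1 then of_real (b_tilde \<nu> \<phi> y) else 0)" for y
      using exhaust_4[of i] exhaust_4[of k]
      by (elim disjE) (simp_all add: B_tilde_def B_inf_eq[OF lim] B_mat_def vector_4 deriv_nonlin b_tilde_def)
    then show ?thesis
      by (cases "i = 3 \<and> k = 1") (auto simp: b_tilde_def intro!: continuous_intros cont)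
  qed
  have G2: "norm (cmat (B_tilde \<mu> \<nu> \<phi> y) *v w) \<le> M * norm w" for y w
  proof -
    have "norm (cmat (B_tilde \<mu> \<nu> \<phi> y) *v w) = \<bar>b_tilde \<nu> \<phi> y\<bar> * norm (w $ 1)"
      by (simp add: B_tilde_mult_vec[OF lim] norm_vec_def L2_set_def sum_4 vector_4 norm_mult)
    also have "\<dots> \<le> M * norm w"
      using M[of y] by (intro mult_mono Finite_Cartesian_Product.norm_nth_le) auto
    finally show ?thesis .
  qed
  have A: "cmat (B_inf \<mu> \<nu> \<phi>) - mat m = eigbasis m1 m2 ** diag_mat d ** eigcobasis m1 m2"
    unfolding B_inf_conj_diag[OF lim ne(1,2) sum prod ne(3)] conj_diag_minus_mat[OF TS] d_def ..
  have B: "eigbasis m1 m2 ** diag_mat (\<lambda>i. d i + m) ** eigcobasis m1 m2 + cmat (B_tilde \<mu> \<nu> \<phi> x) = cmat (B_mat \<mu> \<nu> \<phi> x)" for x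
  proof -
    have "(\<lambda>i. d i + m) = eigval m1 m2" by (simp add: d_def fun_eq_iff)
    then have "eigbasis m1 m2 ** diag_mat (\<lambda>i. d i + m) ** eigcobasis m1 m2 = cmat (B_inf \<mu> \<nu> \<phi>)"
      by (simp only: B_inf_conj_diag[OF lim ne(1,2) sum prod ne(3)])
    then show ?thesis by (simp add: vec_eq_iff B_tilde_def)
  qed
  have d: "Re (d i) \<le> 0" for i
    using exhaust_4[of i] Re_m1 by (auto simp: d_def eigval_def vector_4 Re_m m2)
  have dj: "d j' = 0" by (simp add: d_def col)
  have W1: "W \<in> borel_measurable (lebesgue_on {..- L})"
    and W3: "AE x in lebesgue_on {..- L}. F x = W x"
    using fp by (auto simp: F_minus_fixed_point_def Linf_def F_def)
  have "AE x in lebesgue_on {..- L}. ereal (norm (W x - V_u (rho \<mu>) \<theta> j)) \<le> ereal \<delta>"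
    using esssup_AE by (rule eventually_mono) (rule order_trans[OF _ \<delta>[unfolded Linf_norm_def]])
  then have W2: "AE y in lebesgue_on {..- L}. norm (W y - column j' (eigbasis m1 m2)) \<le> \<delta>"
    by (simp add: V)
  have F: "F x = column j' (eigbasis m1 m2)
      + (LINT y:{..x}|lebesgue. (mat_exp ((x - y) *\<^sub>R (eigbasis m1 m2 ** diag_mat d ** eigcobasis m1 m2))
          ** spectral_projection (eigbasis m1 m2 ** diag_mat d ** eigcobasis m1 m2) {z. Re z < 0}
          ** cmat (B_tilde \<mu> \<nu> \<phi> y)) *v W y)
      - (LINT y:{x..- L}|lebesgue. (mat_exp ((x - y) *\<^sub>R (eigbasis m1 m2 ** diag_mat d ** eigcobasis m1 m2))
          ** spectral_projection (eigbasis m1 m2 ** diag_mat d ** eigcobasis m1 m2) {z. Re z = 0}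
          ** cmat (B_tilde \<mu> \<nu> \<phi> y)) *v W y)" for x
    unfolding F_def F_minus_def Let_def m_def[symmetric] A V ..
  note sol = fixed_point_solution[OF TS d dj G1 G2 W1 W2 W3 F]
  have bound: "norm (F x - V_u (rho \<mu>) \<theta> j) \<le> \<delta>" if "x \<le> - L" for x
    unfolding V using sol(1)[OF that] .
  have tends: "((\<lambda>x. exp (of_real x * m) *s F x) \<longlongrightarrow> 0) at_bot"
  proof (rule tendsto_0_le)
    show "((\<lambda>x. exp (x * Re m)) \<longlongrightarrow> 0) at_bot"
      using Re_m1 unfolding Re_m mult.commute[of _ "Re m1"]
      by (intro filterlim_compose[OF exp_at_bot] filterlim_tendsto_pos_mult_at_bot[OF tendsto_const] filterlim_ident)
    show "\<forall>\<^sub>F x in at_bot. norm (exp (of_real x * m) *s F x) \<le> norm (exp (x * Re m)) * (norm (V_u (rho \<mu>) \<theta> j) + \<delta>)"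
    proof (rule eventually_at_bot_linorderI)
      fix x assume "x \<le> - L"
      then have "norm (F x) \<le> norm (V_u (rho \<mu>) \<theta> j) + \<delta>" using bound[of x] by norm
      moreover have "norm (c *s v) = norm c * norm v" for c and v :: "complex^4"
        by (simp add: norm_vec_def L2_set_def norm_mult power_mult_distrib real_sqrt_mult flip: sum_distrib_left)
      ultimately show "norm (exp (of_real x * m) *s F x) \<le> norm (exp (x * Re m)) * (norm (V_u (rho \<mu>) \<theta> j) + \<delta>)"
        by (simp add: norm_exp_eq_Re mult_left_mono)
    qed
  qed
  show thesis
    using that[OF bound sol(2)[where m = m, unfolded B, unfolded m_def] tends[unfolded m_def]] by blast
qed

theorem proposition3p4:
  fixes \<mu> \<nu> \<theta> L \<epsilon> :: real
    and \<phi> :: "real \<Rightarrow> real"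
    and W :: "nat \<Rightarrow> real \<Rightarrow> complex^4"
  assumes "\<mu> > 0" and "\<nu> > 0"
    and "pulse \<mu> \<nu> \<phi>"
    and "pi / 2 < \<theta>" and "\<theta> < pi" and "tan \<theta> = - sqrt \<mu>"
    and "L > 0"
    and "\<And>j. j \<in> {1, 2} \<Longrightarrow> F_minus_fixed_point \<mu> \<nu> \<phi> \<theta> L j (W j)"
    and "\<And>j. j \<in> {1, 2} \<Longrightarrow>
           Linf_norm (- L) (\<lambda>x. W j x - V_u (rho \<mu>) \<theta> j)
             \<le> ereal (\<epsilon> * norm (V_u (rho \<mu>) \<theta> j))"
    and "\<epsilon> < 1 / (8 * rho \<mu> powr (3 / 2))"
  shows "\<forall>x \<le> - L. Eu_minus \<mu> \<nu> \<phi> x \<inter> l_sand = {0}"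
proof (intro allI impI)
  fix x assume x: "x \<le> - L"
  note mu = assms(1,4,5,6)
  let ?\<delta> = "\<epsilon> * norm (V_u (rho \<mu>) \<theta> 1)"
  have V2: "norm (V_u (rho \<mu>) \<theta> 2) = norm (V_u (rho \<mu>) \<theta> 1)"
    by (simp add: V_u_def norm_vec_def)
  have rho: "rho \<mu> \<ge> 1" using assms(1) by (simp add: rho_def)
  have \<delta>: "?\<delta> < 1 / (4 * rho \<mu>)"
  proof -
    have powr: "rho \<mu> powr (3 / 2) = rho \<mu> * sqrt (rho \<mu>)"
      using rho powr_add[of "rho \<mu>" 1 "1 / 2"] by (simp add: powr_half_sqrt)
    \<comment> \<open>Positivity of the norm keeps the inequality for \<open>\<epsilon>\<close>
      strict after multiplication.\<close>
    have "norm (V_u (rho \<mu>) \<theta> 1) \<noteq> 0"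
    proof -
      have "V_u (rho \<mu>) \<theta> 1 $ 2 = 1" by (simp add: V_u_def V1_u_def vector_4)
      then show ?thesis by (metis norm_eq_zero zero_index zero_neq_one)
    qed
    then have "?\<delta> < 1 / (8 * rho \<mu> powr (3 / 2)) * norm (V_u (rho \<mu>) \<theta> 1)"
      using assms(10) by (intro mult_strict_right_mono) auto
    also have "\<dots> \<le> 1 / (8 * rho \<mu> powr (3 / 2)) * (2 * sqrt (rho \<mu>))"
      using norm_V_u_le[OF mu, of 1] by (intro mult_left_mono) auto
    also have "\<dots> = 1 / (4 * rho \<mu>)" using rho by (simp add: powr)
    finally show ?thesis .
  qed
  obtain F1 where F1: "norm (F1 x - V_u (rho \<mu>) \<theta> 1) \<le> ?\<delta>"
    "\<And>a y. y \<in> {a..- L} \<Longrightarrow> ((\<lambda>y. exp (of_real y * mu_u (rho \<mu>) \<theta> 1) *s F1 y) has_vector_derivative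
        cmat (B_mat \<mu> \<nu> \<phi> y) *v (exp (of_real y * mu_u (rho \<mu>) \<theta> 1) *s F1 y)) (at y within {a..- L})"
    "((\<lambda>y. exp (of_real y * mu_u (rho \<mu>) \<theta> 1) *s F1 y) \<longlongrightarrow> 0) at_bot"
    using fixed_point_decaying_solution[OF mu assms(3) _ assms(8) assms(9), of 1] x by force
  obtain F2 where F2: "norm (F2 x - V_u (rho \<mu>) \<theta> 2) \<le> ?\<delta>"
    "\<And>a y. y \<in> {a..- L} \<Longrightarrow> ((\<lambda>y. exp (of_real y * mu_u (rho \<mu>) \<theta> 2) *s F2 y) has_vector_derivative
        cmat (B_mat \<mu> \<nu> \<phi> y) *v (exp (of_real y * mu_u (rho \<mu>) \<theta> 2) *s F2 y)) (at y within {a..- L})"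
    "((\<lambda>y. exp (of_real y * mu_u (rho \<mu>) \<theta> 2) *s F2 y) \<longlongrightarrow> 0) at_bot"
    using fixed_point_decaying_solution[OF mu assms(3) _ assms(8) assms(9), of 2] x V2 by force
  note minor = minor_nonzero[OF mu F1(1) F2(1) \<delta>]
  have "Q x = 0"
    if Q: "\<And>y. (Q has_vector_derivative (B_mat \<mu> \<nu> \<phi> y *v Q y)) (at y)" "(Q \<longlongrightarrow> 0) at_bot" "Q x \<in> l_sand" for Q
  proof -
    define Qc where "Qc y = (\<chi> i. complex_of_real (Q y $ i))" for y
    have Qc: "(Qc has_vector_derivative cmat (B_mat \<mu> \<nu> \<phi> y) *v Qc y) (at y within {a..- L})" for a y
      unfolding Qc_def[abs_def] by (rule complexify_solution[OF Q(1)])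
    have "(Qc \<longlongrightarrow> 0) at_bot"
      unfolding Qc_def[abs_def]
      by (intro vec_tendstoI) (use tendsto_of_real[OF tendsto_vec_nth[OF Q(2)]] in simp)
    note sympl = sympl_decaying_solutions[OF _ Qc _ this x]
    have s1: "sympl (exp (of_real x * mu_u (rho \<mu>) \<theta> 1) *s F1 x) (Qc x) = 0"
      by (rule sympl[OF F1(2,3)])
    have s2: "sympl (exp (of_real x * mu_u (rho \<mu>) \<theta> 2) *s F2 x) (Qc x) = 0"
      by (rule sympl[OF F2(2,3)])
    obtain u1 u2 where u: "Q x = vector [0, u1, u2, 0]" using Q(3) by (auto simp: l_sand_def)
    \<comment> \<open>On the sandwich plane the form sees only components 1 and 4 of its first
      argument; the exponential factor is nonzero and can be cancelled.\<close>
    have "exp (of_real x * m) * (w $ 1 * of_real u2 - w $ 4 * of_real u1) = sympl (exp (of_real x * m) *s w) (Qc x)" for m w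
      by (simp add: sympl_def Qc_def u vector_4 algebra_simps)
    then have "F1 x $ 1 * of_real u2 = F1 x $ 4 * of_real u1" "F2 x $ 1 * of_real u2 = F2 x $ 4 * of_real u1"
      using s1 s2 by (metis exp_not_eq_zero mult_eq_0_iff right_minus_eq)+
    \<comment> \<open>Cramer's rule for the two equations in \<open>u1\<close> and
      \<open>u2\<close>.\<close>
    then have "(F1 x $ 1 * F2 x $ 4 - F1 x $ 4 * F2 x $ 1) * of_real u1 = 0"
      "(F1 x $ 1 * F2 x $ 4 - F1 x $ 4 * F2 x $ 1) * of_real u2 = 0"
      by algebra+
    then show ?thesis using minor by (simp add: u vec_eq_iff forall_4 vector_4)
  qed
  moreover have "0 \<in> Eu_minus \<mu> \<nu> \<phi> x"
    unfolding Eu_minus_def by (intro CollectI exI[of _ "\<lambda>_. 0"]) simp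
  moreover have "0 \<in> l_sand"
    unfolding l_sand_def by (intro CollectI exI[of _ 0]) (simp add: vec_eq_iff forall_4 vector_4)
  ultimately show "Eu_minus \<mu> \<nu> \<phi> x \<inter> l_sand = {0}"
    by (auto simp: Eu_minus_def)
qed

end
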